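(* Let $k$ be a field of characteristic zero and $D_2 = k_{+}\{x\}/[x^2]$. The algebra $D_2[\partial]$ of differential operators over $D_2$ is prime, i.e. for any two nonzero two-sided ideals $I,J$ of $D_2[\partial]$ one has $IJ\neq 0$.
   Context: $k\{x\}$ denotes the differential polynomial algebra in one indeterminate: the polynomial algebra $k[x_0,x_1,x_2,\dots]$ (with $x = x_0$) with the $k$-linear derivation satisfying $x_n' = x_{n+1}$. $k_{+}\{x\}$ is its subalgebra (without unity) of differential polynomials with zero constant term; $[x^2]$ is the differential ideal (ideal closed under the derivation) of $k_{+}\{x\}$ generated by $x^2$, and $D_2$ carries the induced derivation $a\mapsto a'$. For a differential algebra $A$, the algebra of differential operators $A[\partial]$ consists of finite sums $a_n\partial^n+\cdots+a_1\partial+a_0$ with $a_i\in A$, with multiplication determined by associativity and the rule $\partial a = a\partial + a'$ (so $(a\partial^i)(b\partial^j) = \sum_{l=0}^{i}\binom{i}{l} a\, b^{(l)}\partial^{i+j-l}$). *)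

theory Defs
  imports "HOL-Library.Poly_Mapping"
begin

text \<open>The differential polynomial algebra k{x} = k[x_0,x_1,...]: a monomial is an
exponent vector nat =>0 nat (exponent of x_i at i), a polynomial is a finitely
supported map from monomials to coefficients.\<close>

type_synonym 'k dpoly = "(nat \<Rightarrow>\<^sub>0 nat) \<Rightarrow>\<^sub>0 'k"

definition dvar :: "nat \<Rightarrow> 'k::comm_ring_1 dpoly" where
  "dvar n = Poly_Mapping.single (Poly_Mapping.single n 1) 1"

text \<open>The k-linear derivation with x_n' = x_{n+1} (Leibniz rule on monomials).\<close>
definition dderiv :: "'k::comm_ring_1 dpoly \<Rightarrow> 'k dpoly" where
  "dderiv p = (\<Sum>m\<in>Poly_Mapping.keys p. \<Sum>i\<in>Poly_Mapping.keys (m :: nat \<Rightarrow>\<^sub>0 nat).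
      Poly_Mapping.single (m - Poly_Mapping.single i (1::nat) + Poly_Mapping.single (Suc i) 1)
        (Poly_Mapping.lookup p m * of_nat (Poly_Mapping.lookup m i)))"

definition kplus :: "'k::comm_ring_1 dpoly set" where
  "kplus = {p. Poly_Mapping.lookup p 0 = 0}"

inductive_set dideal_x2 :: "'k::comm_ring_1 dpoly set" where
  gen: "dvar 0 * dvar 0 \<in> dideal_x2"
| zero: "0 \<in> dideal_x2"
| add: "a \<in> dideal_x2 \<Longrightarrow> b \<in> dideal_x2 \<Longrightarrow> a + b \<in> dideal_x2"
| smult: "a \<in> dideal_x2 \<Longrightarrow> Poly_Mapping.single 0 c * a \<in> dideal_x2"
| mult: "a \<in> dideal_x2 \<Longrightarrow> p \<in> kplus \<Longrightarrow> p * a \<in> dideal_x2"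
| deriv: "a \<in> dideal_x2 \<Longrightarrow> dderiv a \<in> dideal_x2"

text \<open>Differential operators over D_2 = k_+{x}/[x^2] are represented by their
coefficient sequences (coefficient of \<partial>^n at n) with coefficients taken as
representatives in k_+{x}; two representatives denote the same operator iff
all coefficients agree modulo [x^2].\<close>

type_synonym 'k dop = "nat \<Rightarrow>\<^sub>0 'k dpoly"

definition Ops :: "'k::comm_ring_1 dop set" where
  "Ops = {u. \<forall>n. Poly_Mapping.lookup u n \<in> kplus}"

definition op_equiv :: "'k::comm_ring_1 dop \<Rightarrow> 'k dop \<Rightarrow> bool" where
  "op_equiv u v \<longleftrightarrow> (\<forall>n. Poly_Mapping.lookup u n - Poly_Mapping.lookup v n \<in> dideal_x2)"

definition op_mul :: "'k::comm_ring_1 dop \<Rightarrow> 'k dop \<Rightarrow> 'k dop" where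
  "op_mul u v = (\<Sum>i\<in>Poly_Mapping.keys u. \<Sum>j\<in>Poly_Mapping.keys v. \<Sum>l\<le>i.
      Poly_Mapping.single (i + j - l)
        (of_nat (i choose l) * Poly_Mapping.lookup u i * (dderiv ^^ l) (Poly_Mapping.lookup v j)))"

text \<open>A two-sided (ring) ideal of D_2[\<partial>], given as the set of all its
representatives (hence saturated under op_equiv).\<close>
definition op_ideal :: "'k::comm_ring_1 dop set \<Rightarrow> bool" where
  "op_ideal I \<longleftrightarrow> I \<subseteq> Ops \<and> 0 \<in> I
     \<and> (\<forall>u\<in>I. \<forall>v\<in>I. u + v \<in> I) \<and> (\<forall>u\<in>I. - u \<in> I)
     \<and> (\<forall>u\<in>I. \<forall>w\<in>Ops. op_mul w u \<in> I \<and> op_mul u w \<in> I)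
     \<and> (\<forall>u\<in>I. \<forall>v\<in>Ops. op_equiv u v \<longrightarrow> v \<in> I)"

definition op_nonzero_ideal :: "'k::comm_ring_1 dop set \<Rightarrow> bool" where
  "op_nonzero_ideal I \<longleftrightarrow> op_ideal I \<and> (\<exists>u\<in>I. \<not> op_equiv u 0)"

end

theory Submission
  imports Defs "HOL-Combinatorics.Permutations" "HOL-Computational_Algebra.Polynomial"
begin

text \<open>Let \<open>d\<^sub>t\<close> be the derivation of \<open>k{x}\<close> with \<open>d\<^sub>t x\<^sub>i = t\<^sup>i\<close>. For \<open>\<alpha>, \<beta>\<close> in \<open>k\<^sup>n\<close> the functional
  \<open>L\<^bsub>\<alpha>,\<beta>\<^esub> p = \<Sum>\<^sub>\<rho> sign(\<rho>) (\<Prod>\<^sub>a d\<^bsub>\<alpha> a + \<beta> (\<rho> a)\<^esub>) p\<close>, evaluated at \<open>x = 0\<close>, vanishes on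
  \<open>[x\<^sup>2]\<close>, because \<open>L (p') = (\<Sum>\<alpha> + \<Sum>\<beta>) L p\<close> and \<open>L\<close> is alternating. These functionals separate the points of
  \<open>k{x}/[x\<^sup>2]\<close>, which is spanned by the monomials \<open>x\<^bsub>i 1\<^esub> \<cdots> x\<^bsub>i n\<^esub>\<close> with \<open>i (j+1) \<ge> i j + 2\<close>. Evaluating
  \<open>L\<close> at the products \<open>a b\<^sup>(\<^sup>l\<^sup>)\<close> for all \<open>l\<close> one finds that \<open>a b\<^sup>(\<^sup>l\<^sup>)\<close> is nonzero for some \<open>l\<close>
  whenever \<open>a\<close> and \<open>b\<close> are nonzero modulo \<open>[x\<^sup>2]\<close>. Commutators with the \<open>x\<^sub>s\<close> show that every nonzero ideal
  of the operator algebra contains a nonzero operator of order 0; for two such operators \<open>a\<close> and \<open>b\<close> the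
  constant coefficient of \<open>a (x\<^sub>s \<partial>\<^sup>l) b\<close> is \<open>a x\<^sub>s b\<^sup>(\<^sup>l\<^sup>)\<close>.\<close>

abbreviation lookup where "lookup \<equiv> Poly_Mapping.lookup"
abbreviation keys where "keys \<equiv> Poly_Mapping.keys"
abbreviation single where "single \<equiv> Poly_Mapping.single"

subsection \<open>Derivations of the polynomial algebra\<close>

text \<open>Both \<open>dderiv\<close> and the derivations with constant coefficients are instances
  of this one formula, so the Leibniz rule is proved once for both.\<close>

definition derivation_of :: "(nat \<Rightarrow> 'k::comm_ring_1 dpoly) \<Rightarrow> 'k dpoly \<Rightarrow> 'k dpoly" where
  "derivation_of c p = (\<Sum>m\<in>keys p. \<Sum>i\<in>keys m.
      single (m - single i 1) (lookup p m * of_nat (lookup m i)) * c i)"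

lemma dderiv_eq_derivation_of: "dderiv = derivation_of (\<lambda>i. dvar (Suc i))"
  by (simp add: fun_eq_iff dderiv_def derivation_of_def dvar_def mult_single)

lemma derivation_of_superset:
  assumes "finite M" "keys p \<subseteq> M"
  shows "derivation_of c p = (\<Sum>m\<in>M. \<Sum>i\<in>keys m.
      single (m - single i 1) (lookup p m * of_nat (lookup m i)) * c i)"
  unfolding derivation_of_def using assms
  by (intro sum.mono_neutral_left) (auto simp: in_keys_iff)

lemma derivation_of_add: "derivation_of c (p + q) = derivation_of c p + derivation_of c q"
proof -
  let ?M = "keys p \<union> keys q"
  have M: "finite ?M" "keys p \<subseteq> ?M" "keys q \<subseteq> ?M" "keys (p + q) \<subseteq> ?M"
    using Poly_Mapping.keys_add[of p q] by auto
  show ?thesis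
    unfolding derivation_of_superset[OF M(1,2)] derivation_of_superset[OF M(1,3)]
      derivation_of_superset[OF M(1,4)] sum.distrib[symmetric]
    by (intro sum.cong refl) (simp add: lookup_add algebra_simps single_add)
qed

lemma derivation_of_zero [simp]: "derivation_of c 0 = 0"
  by (simp add: derivation_of_def)

lemma derivation_of_sum: "derivation_of c (sum f A) = (\<Sum>x\<in>A. derivation_of c (f x))"
  by (induction A rule: infinite_finite_induct) (auto simp: derivation_of_add)

lemma derivation_of_single:
  "derivation_of c (single m a) =
    (\<Sum>i\<in>keys m. single (m - single i 1) (a * of_nat (lookup m i)) * c i)"
  using derivation_of_superset[of "{m}" "single m a" c] by simp

lemma poly_mapping_eq_sum_single: "p = (\<Sum>m\<in>keys p. single m (lookup p m))"
  by (rule poly_mapping_eqI)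
    (auto simp: lookup_sum lookup_single when_def in_keys_iff sum.delta)

lemma derivation_of_mult_single:
  "derivation_of c (single m a * single n b) =
    derivation_of c (single m a) * single n b + single m a * derivation_of c (single n b)"
proof -
  let ?K = "keys m \<union> keys n"
  have ext: "derivation_of c (single l d) =
      (\<Sum>i\<in>?K. single (l - single i 1) (d * of_nat (lookup l i)) * c i)"
    if "keys l \<subseteq> ?K" for l d
    unfolding derivation_of_single using that
    by (intro sum.mono_neutral_left) (auto simp: in_keys_iff)
  \<comment> \<open>Subtraction of exponents is truncated. This could matter only if x_i does not
    divide m, and then the coefficient \<open>lookup m i\<close> is zero.\<close>
  have shift: "single (m + n - single i 1) (e * of_nat (lookup m i)) =
      single (m - single i 1) (e * of_nat (lookup m i)) * single n 1"
    for e :: 'a and i and m n :: "nat \<Rightarrow>\<^sub>0 nat"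
  proof (cases "lookup m i = 0")
    case False
    then have "m + n - single i 1 = (m - single i 1) + n"
      by (intro poly_mapping_eqI) (auto simp: lookup_add lookup_minus lookup_single when_def)
    then show ?thesis by (simp add: mult_single)
  qed simp
  have "single (m + n - single i 1) (a * b * of_nat (lookup (m + n) i)) =
      single (m - single i 1) (a * of_nat (lookup m i)) * single n b +
      single m a * single (n - single i 1) (b * of_nat (lookup n i))" for i
  proof -
    have "single (m + n - single i 1) (a * b * of_nat (lookup (m + n) i)) =
        single (m + n - single i 1) (a * b * of_nat (lookup m i)) +
        single (n + m - single i 1) (a * b * of_nat (lookup n i))"
      by (simp add: lookup_add single_add[symmetric] algebra_simps)
    then show ?thesis
      unfolding shift by (simp add: mult_single algebra_simps)
  qed
  then show ?thesis
    using Poly_Mapping.keys_add[of m n]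
    by (simp add: mult_single ext sum_distrib_left sum_distrib_right sum.distrib[symmetric] algebra_simps)
qed

lemma derivation_of_mult:
  "derivation_of c (p * q) = derivation_of c p * q + p * derivation_of c q"
proof -
  have "derivation_of c (p * q) = (\<Sum>m\<in>keys p. \<Sum>n\<in>keys q.
      derivation_of c (single m (lookup p m) * single n (lookup q n)))"
    by (subst (1) poly_mapping_eq_sum_single[of p], subst (1) poly_mapping_eq_sum_single[of q])
      (simp add: sum_product derivation_of_sum)
  also have "\<dots> = (\<Sum>m\<in>keys p. derivation_of c (single m (lookup p m))) * (\<Sum>n\<in>keys q. single n (lookup q n))
     + (\<Sum>m\<in>keys p. single m (lookup p m)) * (\<Sum>n\<in>keys q. derivation_of c (single n (lookup q n)))"
    by (simp add: derivation_of_mult_single sum_product sum.distrib)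
  also have "\<dots> = derivation_of c p * q + p * derivation_of c q"
    by (simp add: poly_mapping_eq_sum_single[symmetric] derivation_of_sum[symmetric])
  finally show ?thesis .
qed

lemma derivation_of_const [simp]: "derivation_of c (single 0 a) = 0"
  by (simp add: derivation_of_single)

lemma derivation_of_dvar [simp]: "derivation_of c (dvar i) = c i"
  by (simp add: dvar_def derivation_of_single)

text \<open>Constants and variables generate the algebra, so identities between derivations need
  checking only on these generators.\<close>

lemma dpoly_induct [case_names const var add mult]:
  fixes p :: "'k::comm_ring_1 dpoly"
  assumes const: "\<And>a. P (single 0 a)" and var: "\<And>i. P (dvar i)"
    and add: "\<And>p q. P p \<Longrightarrow> P q \<Longrightarrow> P (p + q)" and mult: "\<And>p q. P p \<Longrightarrow> P q \<Longrightarrow> P (p * q)"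
  shows "P p"
proof -
  have pow: "P (single (single i e) 1)" for i e
  proof (induction e)
    case 0 then show ?case using const[of 1] by simp
  next
    case (Suc e)
    have "single (single i (Suc e)) 1 = dvar i * single (single i e) (1::'k)"
      by (simp add: dvar_def mult_single single_add[symmetric])
    then show ?case using mult[OF var Suc] by simp
  qed
  have mon: "P (single m 1)" for m
  proof -
    have "P (single (\<Sum>i\<in>A. single i (lookup m i)) 1)" if "finite A" for A
      using that
    proof (induction A)
      case empty then show ?case using const[of 1] by simp
    next
      case (insert i A)
      then show ?case using mult[OF pow[of i "lookup m i"] insert.IH] by (simp add: mult_single)
    qed
    from this[of "keys m"] show ?thesis by (simp add: poly_mapping_eq_sum_single[symmetric])
  qed
  have sing: "P (single m a)" for m a
    using mult[OF const[of a] mon[of m]] by (simp add: mult_single)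
  have "P 0" using const[of 0] by simp
  have "P (\<Sum>m\<in>A. single m (lookup p m))" if "finite A" for A
    using that \<open>P 0\<close> by (induction A rule: finite_induct) (auto intro: add sing)
  from this[of "keys p"] show ?thesis by (simp add: poly_mapping_eq_sum_single[symmetric])
qed

subsection \<open>Derivations with constant coefficients\<close>

definition const_deriv :: "(nat \<Rightarrow> 'k::comm_ring_1) \<Rightarrow> 'k dpoly \<Rightarrow> 'k dpoly" where
  "const_deriv c = derivation_of (\<lambda>i. single 0 (c i))"

abbreviation exp_deriv :: "'k::comm_ring_1 \<Rightarrow> 'k dpoly \<Rightarrow> 'k dpoly" where
  "exp_deriv t \<equiv> const_deriv (\<lambda>i. t ^ i)"

abbreviation const_term :: "'k::comm_ring_1 dpoly \<Rightarrow> 'k" where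
  "const_term p \<equiv> lookup p 0"

lemma lookup_const_mult: "lookup (single 0 a * p) m = a * lookup p (m :: nat \<Rightarrow>\<^sub>0 nat)"
proof -
  have "single 0 a * p = (\<Sum>n\<in>keys p. single n (a * lookup p n))"
    by (subst (1) poly_mapping_eq_sum_single[of p]) (simp add: sum_distrib_left mult_single)
  then show ?thesis
    by (auto simp: lookup_sum lookup_single when_def in_keys_iff)
qed

lemma const_deriv_add: "const_deriv c (p + q) = const_deriv c p + const_deriv c q"
  by (simp add: const_deriv_def derivation_of_add)

lemma const_deriv_mult: "const_deriv c (p * q) = const_deriv c p * q + p * const_deriv c q"
  by (simp add: const_deriv_def derivation_of_mult)

lemma const_deriv_const [simp]: "const_deriv c (single 0 a) = 0"
  by (simp add: const_deriv_def)

lemma const_deriv_dvar [simp]: "const_deriv c (dvar i) = single 0 (c i)"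
  by (simp add: const_deriv_def)

lemma const_deriv_zero [simp]: "const_deriv c 0 = 0"
  by (simp add: const_deriv_def)

lemma const_deriv_scale: "const_deriv c (single 0 a * p) = single 0 a * const_deriv c p"
  by (simp add: const_deriv_mult)

lemma dderiv_add: "dderiv (p + q) = dderiv p + dderiv q"
  and dderiv_mult: "dderiv (p * q) = dderiv p * q + p * dderiv q"
  and dderiv_const [simp]: "dderiv (single 0 a) = 0"
  and dderiv_dvar [simp]: "dderiv (dvar i) = dvar (Suc i)"
  and dderiv_zero [simp]: "dderiv 0 = 0"
  and dderiv_sum: "dderiv (sum f A) = (\<Sum>x\<in>A. dderiv (f x))"
  by (simp_all add: dderiv_eq_derivation_of derivation_of_add derivation_of_mult derivation_of_sum)

text \<open>The commutator of two derivations is a derivation, so it suffices to compare on x_i,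
  where d_t x_(i+1) = t d_t x_i and the constant d_t x_i has derivative 0. The values t^i make d_t
  an eigenvector for commutation with \<open>dderiv\<close>.\<close>

lemma exp_deriv_dderiv:
  "exp_deriv t (dderiv p) = dderiv (exp_deriv t p) + single 0 t * exp_deriv t p"
proof (induction p rule: dpoly_induct)
  case (var i)
  show ?case by (simp add: mult_single)
qed (simp_all add: const_deriv_add const_deriv_mult dderiv_add dderiv_mult algebra_simps)

lemma const_term_mult [simp]:
  "const_term (p * q) = const_term p * const_term (q :: 'k::comm_ring_1 dpoly)"
proof (induction p arbitrary: q rule: dpoly_induct)
  case (const a)
  show ?case by (simp add: lookup_const_mult)
next
  case (var i)
  have "dvar i * q = (\<Sum>n\<in>keys q. single (single i 1 + n) (lookup q n))"
    unfolding dvar_def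
    by (subst (1) poly_mapping_eq_sum_single[of q]) (simp add: sum_distrib_left mult_single)
  moreover have "single i 1 + n \<noteq> (0 :: nat \<Rightarrow>\<^sub>0 nat)" for n
  proof
    assume "single i 1 + n = 0"
    then have "lookup (single i 1 + n) i = 0" by simp
    then show False by (simp add: lookup_add)
  qed
  moreover have "single i 1 \<noteq> (0 :: nat \<Rightarrow>\<^sub>0 nat)"
    by (metis lookup_single_eq lookup_zero zero_neq_one)
  ultimately show ?case
    by (simp add: lookup_sum lookup_single dvar_def when_def)
qed (simp_all add: lookup_add mult.assoc distrib_right)

lemma const_term_dvar [simp]: "const_term (dvar i) = 0"
proof -
  have "single i 1 \<noteq> (0 :: nat \<Rightarrow>\<^sub>0 nat)"
    by (metis lookup_single_eq lookup_zero zero_neq_one)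
  then show ?thesis by (simp add: dvar_def lookup_single)
qed

lemma const_term_dderiv [simp]: "const_term (dderiv p) = 0"
  by (induction p rule: dpoly_induct) (simp_all add: dderiv_add dderiv_mult lookup_add)

text \<open>In the i-th partial derivative the monomial m arises only from m x_i, and the exponent
  of x_i in that product is the factor.\<close>

lemma lookup_const_deriv:
  assumes "finite V" "\<And>n. n \<in> keys p \<Longrightarrow> keys n \<subseteq> V"
  shows "lookup (const_deriv c p) m =
    (\<Sum>i\<in>V. c i * of_nat (Suc (lookup m i)) * lookup p (m + single i 1))"
proof -
  have eq: "(n - single i 1 = m \<and> lookup n i \<noteq> 0) \<longleftrightarrow> n = m + single i 1" for n i
  proof
    assume "n - single i 1 = m \<and> lookup n i \<noteq> 0"
    then show "n = m + single i 1"
      by (auto intro!: poly_mapping_eqI simp: lookup_add lookup_minus lookup_single when_def)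
  qed (simp add: lookup_add)
  have "lookup (const_deriv c p) m = (\<Sum>n\<in>keys p. \<Sum>i\<in>keys n.
      (lookup p n * of_nat (lookup n i) * c i when n - single i 1 = m))"
    by (simp add: const_deriv_def derivation_of_def lookup_sum mult_single lookup_single)
  also have "\<dots> = (\<Sum>n\<in>keys p. \<Sum>i\<in>V.
      (lookup p n * of_nat (lookup n i) * c i when n - single i 1 = m))"
    using assms by (intro sum.cong refl sum.mono_neutral_left) (auto simp: in_keys_iff)
  also have "\<dots> = (\<Sum>n\<in>keys p. \<Sum>i\<in>V.
      (if m + single i 1 = n then c i * of_nat (Suc (lookup m i)) * lookup p (m + single i 1) else 0))"
  proof (intro sum.cong refl)
    fix n i
    show "(lookup p n * of_nat (lookup n i) * c i when n - single i 1 = m) =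
      (if m + single i 1 = n then c i * of_nat (Suc (lookup m i)) * lookup p (m + single i 1) else 0)"
      using eq[of n i] by (cases "lookup n i = 0") (auto simp: when_def lookup_add algebra_simps)
  qed
  also have "\<dots> = (\<Sum>i\<in>V. \<Sum>n\<in>keys p.
      (if m + single i 1 = n then c i * of_nat (Suc (lookup m i)) * lookup p (m + single i 1) else 0))"
    by (rule sum.swap)
  also have "\<dots> = (\<Sum>i\<in>V. c i * of_nat (Suc (lookup m i)) * lookup p (m + single i 1))"
    by (intro sum.cong refl) (auto simp: in_keys_iff)
  finally show ?thesis .
qed

subsection \<open>Alternating functionals\<close>

primrec iter_deriv :: "(nat \<Rightarrow> 'k::comm_ring_1) \<Rightarrow> nat list \<Rightarrow> 'k dpoly \<Rightarrow> 'k dpoly" where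
  "iter_deriv g [] p = p"
| "iter_deriv g (a # xs) p = iter_deriv g xs (exp_deriv (g a) p)"

text \<open>The indices are given by a list rather than a number, so that disjoint blocks of indices
  can be assigned to the two factors of a product.\<close>

definition alt_form ::
    "nat list \<Rightarrow> (nat \<Rightarrow> 'k::comm_ring_1) \<Rightarrow> (nat \<Rightarrow> 'k) \<Rightarrow> 'k dpoly \<Rightarrow> 'k" where
  "alt_form xs \<alpha> \<beta> p = (\<Sum>\<rho> | \<rho> permutes set xs.
      of_int (sign \<rho>) * const_term (iter_deriv (\<lambda>a. \<alpha> a + \<beta> (\<rho> a)) xs p))"

lemma iter_deriv_zero [simp]: "iter_deriv g xs 0 = 0"
  by (induction xs) simp_all

lemma iter_deriv_add: "iter_deriv g xs (p + q) = iter_deriv g xs p + iter_deriv g xs q"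
  by (induction xs arbitrary: p q) (simp_all add: const_deriv_add)

lemma iter_deriv_scale: "iter_deriv g xs (single 0 a * p) = single 0 a * iter_deriv g xs p"
  by (induction xs arbitrary: p) (simp_all add: const_deriv_scale)

lemma iter_deriv_cong:
  "(\<And>a. a \<in> set xs \<Longrightarrow> g a = h a) \<Longrightarrow> iter_deriv g xs p = iter_deriv h xs p"
  by (induction xs arbitrary: p) simp_all

text \<open>Each derivation acts on one of the two factors, and S collects those acting on p. The
  induction separates the S that contain the head of the list from those that do not.\<close>

lemma iter_deriv_mult:
  assumes "distinct xs"
  shows "iter_deriv g xs (p * q) = (\<Sum>S\<in>Pow (set xs).
    iter_deriv g (filter (\<lambda>a. a \<in> S) xs) p * iter_deriv g (filter (\<lambda>a. a \<notin> S) xs) q)"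
  using assms
proof (induction xs arbitrary: p q)
  case (Cons a xs)
  let ?F = "\<lambda>xs S p q. iter_deriv g (filter (\<lambda>a. a \<in> S) xs) p * iter_deriv g (filter (\<lambda>a. a \<notin> S) xs) q"
  have inj: "inj_on (insert a) (Pow (set xs))"
    using Cons.prems by (auto simp: inj_on_def)
  have split: "Pow (set (a # xs)) = Pow (set xs) \<union> insert a ` Pow (set xs)"
    by (simp add: Pow_insert)
  have disj: "Pow (set xs) \<inter> insert a ` Pow (set xs) = {}"
    using Cons.prems by auto
  have in1: "?F (a # xs) S p q = ?F xs S p (exp_deriv (g a) q)" if "S \<in> Pow (set xs)" for S
    using that Cons.prems by auto
  have in2: "?F (a # xs) (insert a S) p q = ?F xs S (exp_deriv (g a) p) q"
    if "S \<in> Pow (set xs)" for S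
  proof -
    have "filter (\<lambda>b. b \<in> insert a S) xs = filter (\<lambda>b. b \<in> S) xs"
      "filter (\<lambda>b. b \<notin> insert a S) xs = filter (\<lambda>b. b \<notin> S) xs"
      using Cons.prems by (auto intro!: filter_cong)
    then show ?thesis by simp
  qed
  have "(\<Sum>S\<in>Pow (set (a # xs)). ?F (a # xs) S p q) =
      (\<Sum>S\<in>Pow (set xs). ?F (a # xs) S p q) + (\<Sum>S\<in>insert a ` Pow (set xs). ?F (a # xs) S p q)"
    unfolding split using disj by (intro sum.union_disjoint) auto
  also have "(\<Sum>S\<in>insert a ` Pow (set xs). ?F (a # xs) S p q) =
      (\<Sum>S\<in>Pow (set xs). ?F (a # xs) (insert a S) p q)"
    by (subst sum.reindex[OF inj]) (simp add: o_def)
  also have "(\<Sum>S\<in>Pow (set xs). ?F (a # xs) S p q) + \<dots> =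
     (\<Sum>S\<in>Pow (set xs). ?F xs S p (exp_deriv (g a) q)) + (\<Sum>S\<in>Pow (set xs). ?F xs S (exp_deriv (g a) p) q)"
    using in1 in2 by (intro arg_cong2[of _ _ _ _ "(+)"] sum.cong refl) auto
  also have "\<dots> = iter_deriv g (a # xs) (p * q)"
    using Cons by (simp add: const_deriv_mult iter_deriv_add add.commute)
  finally show ?case ..
qed simp

text \<open>Moving \<open>dderiv\<close> outwards past each d_t leaves a summand with factor t; the
  last remaining term is a derivative and has constant term 0.\<close>

lemma const_term_iter_deriv_dderiv:
  "const_term (iter_deriv g xs (dderiv p)) = (\<Sum>a\<leftarrow>xs. g a) * const_term (iter_deriv g xs p)"
  by (induction xs arbitrary: p)
    (simp_all add: exp_deriv_dderiv iter_deriv_add iter_deriv_scale lookup_add distrib_right)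

lemma const_term_iter_deriv_dderiv_pow:
  "const_term (iter_deriv g xs ((dderiv ^^ l) p)) = (\<Sum>a\<leftarrow>xs. g a) ^ l * const_term (iter_deriv g xs p)"
  by (induction l) (simp_all add: const_term_iter_deriv_dderiv)

lemma alt_form_add: "alt_form xs \<alpha> \<beta> (p + q) = alt_form xs \<alpha> \<beta> p + alt_form xs \<alpha> \<beta> q"
  by (simp add: alt_form_def iter_deriv_add lookup_add distrib_left sum.distrib)

text \<open>Each summand is multiplied by the sum of all \<alpha> a + \<beta> (\<rho> a). Permuting
  the \<beta> values does not change their sum, so the scalar is the same for every \<rho>.\<close>

lemma alt_form_dderiv:
  assumes "distinct xs"
  shows "alt_form xs \<alpha> \<beta> (dderiv p) = (\<Sum>a\<in>set xs. \<alpha> a + \<beta> a) * alt_form xs \<alpha> \<beta> p"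
proof -
  have "(\<Sum>a\<leftarrow>xs. \<alpha> a + \<beta> (\<rho> a)) = (\<Sum>a\<in>set xs. \<alpha> a + \<beta> a)" if "\<rho> permutes set xs" for \<rho>
    using assms sum.permute[OF that, of \<beta>]
    by (simp add: sum_list_distinct_conv_sum_set sum.distrib)
  then show ?thesis
    by (simp add: alt_form_def const_term_iter_deriv_dderiv sum_distrib_left mult.left_commute)
qed

text \<open>Two factors \<open>x\<^sub>0\<close> absorb two of the derivations, say those with indices \<open>a\<close> and \<open>b\<close>, to
  give a constant; what remains does not see the transposition of \<open>a\<close> and \<open>b\<close>, which changes the sign.\<close>

lemma alt_form_dvar_square:
  fixes \<alpha> \<beta> :: "nat \<Rightarrow> 'k::field_char_0"
  assumes "distinct xs"
  shows "alt_form xs \<alpha> \<beta> (dvar 0 * dvar 0 * q) = 0"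
proof -
  let ?g = "\<lambda>\<rho> a. \<alpha> a + \<beta> (\<rho> a)"
  \<comment> \<open>Every d_t sends x_0 to t^0 = 1, so two of them turn the square into the constant
    2. With fewer the constant term is still 0, with more the result is 0.\<close>
  have sq: "const_term (iter_deriv g ys (dvar 0 * dvar 0)) = (if length ys = 2 then 2 else 0)"
    for g :: "nat \<Rightarrow> 'k" and ys
  proof -
    have "iter_deriv g zs (single 0 c) = (if zs = [] then single 0 c else 0)" for zs c
      by (cases zs) simp_all
    moreover have "const_deriv c 2 = 0" for c :: "nat \<Rightarrow> 'k"
      using const_deriv_const[of c 2] by simp
    ultimately show ?thesis
      by (cases ys; cases "tl ys"; cases "tl (tl ys)") 
         (auto simp: const_deriv_mult const_deriv_add lookup_add lookup_numeral)
  qed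
  have zero: "(\<Sum>\<rho> | \<rho> permutes set xs. of_int (sign \<rho>) *
      const_term (iter_deriv (?g \<rho>) (filter (\<lambda>a. a \<notin> S) xs) q)) = 0" (is "?L = 0")
    if S: "S \<subseteq> set xs" "card S = 2" for S
  proof -
    obtain a b where ab: "S = {a, b}" "a \<noteq> b" using S(2) by (meson card_2_iff)
    let ?t = "transpose a b"
    have t: "?t permutes set xs" using S ab by (intro permutes_swap_id) auto
    have "?L = (\<Sum>\<rho> | \<rho> permutes set xs. of_int (sign (\<rho> \<circ> ?t)) *
        const_term (iter_deriv (?g (\<rho> \<circ> ?t)) (filter (\<lambda>a. a \<notin> S) xs) q))"
      by (rule sum.reindex_bij_witness[of _ "\<lambda>\<rho>. \<rho> \<circ> ?t" "\<lambda>\<rho>. \<rho> \<circ> ?t"])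
        (auto simp: o_assoc[symmetric] permutes_compose[OF t])
    also have "\<dots> = (\<Sum>\<rho> | \<rho> permutes set xs. - (of_int (sign \<rho>) *
        const_term (iter_deriv (?g \<rho>) (filter (\<lambda>a. a \<notin> S) xs) q)))"
    proof (intro sum.cong refl)
      fix \<rho> assume "\<rho> \<in> {\<rho>. \<rho> permutes set xs}"
      then have "sign (\<rho> \<circ> ?t) = - sign \<rho>"
        using ab t by (simp add: sign_compose sign_swap_id permutes_imp_permutation[of "set xs"])
      moreover have "iter_deriv (?g (\<rho> \<circ> ?t)) (filter (\<lambda>a. a \<notin> S) xs) q =
          iter_deriv (?g \<rho>) (filter (\<lambda>a. a \<notin> S) xs) q"
        using ab by (intro iter_deriv_cong) (auto simp: transpose_def)
      ultimately show "of_int (sign (\<rho> \<circ> ?t)) *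
          const_term (iter_deriv (?g (\<rho> \<circ> ?t)) (filter (\<lambda>a. a \<notin> S) xs) q) =
          - (of_int (sign \<rho>) * const_term (iter_deriv (?g \<rho>) (filter (\<lambda>a. a \<notin> S) xs) q))"
        by simp
    qed
    \<comment> \<open>In characteristic 0, being equal to its own negative forces \<open>?L\<close>
      to vanish.\<close>
    also have "\<dots> = - ?L" by (simp add: sum_negf)
    finally show ?thesis by simp
  qed
  have len: "length (filter (\<lambda>a. a \<in> S) xs) = card S" if "S \<subseteq> set xs" for S
  proof -
    have "S = set (filter (\<lambda>a. a \<in> S) xs)" using that by auto
    then show ?thesis using assms by (metis distinct_card distinct_filter)
  qed
  have "alt_form xs \<alpha> \<beta> (dvar 0 * dvar 0 * q) =
    (\<Sum>\<rho> | \<rho> permutes set xs. \<Sum>S\<in>Pow (set xs). (if card S = 2 then 2 else 0) *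
      (of_int (sign \<rho>) * const_term (iter_deriv (?g \<rho>) (filter (\<lambda>a. a \<notin> S) xs) q)))"
    unfolding alt_form_def iter_deriv_mult[OF assms] lookup_sum const_term_mult sq sum_distrib_left
    by (intro sum.cong refl) (simp add: len mult.left_commute)
  also have "\<dots> = (\<Sum>S\<in>Pow (set xs). (if card S = 2 then 2 else 0) *
      (\<Sum>\<rho> | \<rho> permutes set xs. of_int (sign \<rho>) * const_term (iter_deriv (?g \<rho>) (filter (\<lambda>a. a \<notin> S) xs) q)))"
    by (subst sum.swap) (simp add: sum_distrib_left)
  also have "\<dots> = 0" by (intro sum.neutral) (auto simp: zero)
  finally show ?thesis .
qed

lemma alt_form_dideal_x2:
  fixes \<alpha> \<beta> :: "nat \<Rightarrow> 'k::field_char_0"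
  assumes "p \<in> dideal_x2" "distinct xs"
  shows "alt_form xs \<alpha> \<beta> p = 0"
proof -
  \<comment> \<open>The arbitrary cofactor q makes the induction work: multiplications are absorbed
    into q, and a derivative is handled by a' q = (a q)' - a q'.\<close>
  have "alt_form xs \<alpha> \<beta> (p * q) = 0" for q
    using assms(1)
  proof (induction p arbitrary: q)
    case gen
    show ?case using alt_form_dvar_square[OF assms(2)] .
  next
    case zero
    show ?case by (simp add: alt_form_def)
  next
    case (add a b)
    then show ?case by (simp add: distrib_right alt_form_add)
  next
    case (smult a c)
    from smult.IH[of "single 0 c * q"] show ?case by (simp add: mult_ac)
  next
    case (mult a p)
    from mult.IH[of "p * q"] show ?case by (simp add: mult_ac)
  next
    case (deriv a)
    have "alt_form xs \<alpha> \<beta> (dderiv a * q) + alt_form xs \<alpha> \<beta> (a * dderiv q) = 0"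
      unfolding alt_form_add[symmetric] dderiv_mult[symmetric]
      using deriv.IH[of q] by (simp add: alt_form_dderiv[OF assms(2)])
    then show ?case using deriv.IH[of "dderiv q"] by simp
  qed
  from this[of 1] show ?thesis by simp
qed

text \<open>For a distinct list this is the product of the factorials of the exponents of the
  monomial with factors x_(i a), built up one factor at a time.\<close>

primrec mono_weight :: "(nat \<Rightarrow> nat) \<Rightarrow> nat list \<Rightarrow> nat" where
  "mono_weight i [] = 1"
| "mono_weight i (a # xs) =
    mono_weight i xs * Suc (lookup (\<Sum>b\<in>set xs. single (i b) (1::nat)) (i a))"

lemma mono_weight_cong:
  "(\<And>a. a \<in> set xs \<Longrightarrow> i a = j a) \<Longrightarrow> mono_weight i xs = mono_weight j xs"
  by (induction xs) (simp_all cong: sum.cong)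

lemma mono_weight_nonzero: "mono_weight i xs \<noteq> 0"
  by (induction xs) simp_all

text \<open>Expand each derivation into partial derivatives: the choice i picks the variable x_(i a)
  for the index a and contributes \<open>g a ^ i a\<close>. The iterated partial derivative at 0 is
  a coefficient of p times the product of factorials.\<close>

lemma const_term_iter_deriv:
  assumes "distinct xs" "finite V" "\<And>m. m \<in> keys p \<Longrightarrow> keys m \<subseteq> V"
  shows "const_term (iter_deriv g xs p) = (\<Sum>i\<in>PiE (set xs) (\<lambda>_. V).
    (\<Prod>a\<in>set xs. g a ^ i a) * (of_nat (mono_weight i xs) * lookup p (\<Sum>a\<in>set xs. single (i a) 1)))"
  using assms(1,3)
proof (induction xs arbitrary: p)
  case (Cons a xs)
  let ?M = "\<lambda>i xs. \<Sum>b\<in>set xs. single (i b) (1::nat)"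
  have a: "a \<notin> set xs" using Cons.prems by simp
  \<comment> \<open>The derivation introduces no new variables, so the induction hypothesis applies
    with the same V.\<close>
  have V: "keys m \<subseteq> V" if "m \<in> keys (exp_deriv (g a) p)" for m
  proof -
    have "(\<Sum>i\<in>V. g a ^ i * of_nat (Suc (lookup m i)) * lookup p (m + single i 1)) \<noteq> 0"
      using that lookup_const_deriv[OF assms(2) Cons.prems(2), where c = "\<lambda>i. g a ^ i" and m = m]
      by (simp add: in_keys_iff)
    then obtain i where "lookup p (m + single i 1) \<noteq> 0"
      by (metis (no_types, lifting) mult_zero_right sum.not_neutral_contains_not_neutral)
    then have "keys (m + single i 1) \<subseteq> V" using Cons.prems(2) by (simp add: in_keys_iff)
    then show ?thesis by (auto simp: in_keys_iff lookup_add)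
  qed
  have inj: "inj_on (\<lambda>(y, i). i(a := y)) (V \<times> PiE (set xs) (\<lambda>_. V))"
    using inj_combinator[OF a, of "\<lambda>_. V"] by simp
  have "const_term (iter_deriv g (a # xs) p) = (\<Sum>i\<in>PiE (set xs) (\<lambda>_. V).
    (\<Prod>b\<in>set xs. g b ^ i b) * (of_nat (mono_weight i xs) *
      (\<Sum>j\<in>V. g a ^ j * of_nat (Suc (lookup (?M i xs) j)) * lookup p (?M i xs + single j 1))))"
    using Cons.IH[OF _ V] Cons.prems(1)
    by (simp add: lookup_const_deriv[OF assms(2) Cons.prems(2)])
  also have "\<dots> = (\<Sum>i\<in>PiE (set xs) (\<lambda>_. V). \<Sum>j\<in>V.
     (\<Prod>b\<in>set (a # xs). g b ^ (i(a := j)) b) * (of_nat (mono_weight (i(a := j)) (a # xs)) *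
       lookup p (?M (i(a := j)) (a # xs))))"
  proof (intro sum.cong refl)
    fix i
    have upd: "(\<Prod>b\<in>set (a # xs). g b ^ (i(a := j)) b) = g a ^ j * (\<Prod>b\<in>set xs. g b ^ i b)"
      "mono_weight (i(a := j)) (a # xs) = mono_weight i xs * Suc (lookup (?M i xs) j)"
      "?M (i(a := j)) (a # xs) = ?M i xs + single j 1" for j
    proof -
      have *: "(i(a := j)) b = i b" if "b \<in> set xs" for b using that a by auto
      then show "(\<Prod>b\<in>set (a # xs). g b ^ (i(a := j)) b) = g a ^ j * (\<Prod>b\<in>set xs. g b ^ i b)"
        using a by (simp cong: prod.cong)
      have M: "?M (i(a := j)) xs = ?M i xs" using * by (intro sum.cong) simp_all
      show "mono_weight (i(a := j)) (a # xs) = mono_weight i xs * Suc (lookup (?M i xs) j)"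
        using mono_weight_cong[of xs "i(a := j)" i] * M by simp
      show "?M (i(a := j)) (a # xs) = ?M i xs + single j 1"
        using M a by (simp add: add.commute)
    qed
    show "(\<Prod>b\<in>set xs. g b ^ i b) * (of_nat (mono_weight i xs) *
      (\<Sum>j\<in>V. g a ^ j * of_nat (Suc (lookup (?M i xs) j)) * lookup p (?M i xs + single j 1))) =
      (\<Sum>j\<in>V. (\<Prod>b\<in>set (a # xs). g b ^ (i(a := j)) b) * (of_nat (mono_weight (i(a := j)) (a # xs)) *
       lookup p (?M (i(a := j)) (a # xs))))"
      unfolding upd of_nat_mult sum_distrib_left by (intro sum.cong refl) (simp only: mult_ac)
  qed
  also have "\<dots> = (\<Sum>(j, i)\<in>V \<times> PiE (set xs) (\<lambda>_. V).
     (\<Prod>b\<in>set (a # xs). g b ^ (i(a := j)) b) * (of_nat (mono_weight (i(a := j)) (a # xs)) *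
       lookup p (?M (i(a := j)) (a # xs))))"
    unfolding sum.cartesian_product[symmetric] by (rule sum.swap)
  also have "\<dots> = (\<Sum>i\<in>PiE (set (a # xs)) (\<lambda>_. V).
     (\<Prod>b\<in>set (a # xs). g b ^ i b) * (of_nat (mono_weight i (a # xs)) * lookup p (?M i (a # xs))))"
    unfolding list.set PiE_insert_eq
    by (subst sum.reindex[OF inj]) (simp only: o_def case_prod_unfold list.set)
  finally show ?case .
qed simp

subsection \<open>Normal monomials span modulo the ideal\<close>

text \<open>Split p into its constant term, covered by the scalar rule, and a remainder in
  \<open>kplus\<close>.\<close>

lemma dideal_x2_mult:
  assumes "a \<in> dideal_x2"
  shows "p * a \<in> dideal_x2"
proof -
  let ?c = "single 0 (const_term p)"
  have "p - ?c \<in> kplus" by (simp add: kplus_def lookup_minus)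
  then have "?c * a + (p - ?c) * a \<in> dideal_x2"
    using assms by (intro dideal_x2.intros)
  then show ?thesis by (simp add: algebra_simps)
qed

lemma dideal_x2_sum: "(\<And>x. x \<in> A \<Longrightarrow> f x \<in> dideal_x2) \<Longrightarrow> sum f A \<in> dideal_x2"
  by (induction A rule: infinite_finite_induct) (auto intro: dideal_x2.intros)

section \<open>Quadratic relations from the derivatives of x_0^2, and rewriting with them\<close>

lemma sum_choose_Suc:
  fixes F :: "nat \<Rightarrow> 'a::comm_semiring_1"
  shows "(\<Sum>j\<le>Suc l. of_nat (Suc l choose j) * F j) = (\<Sum>j\<le>l. of_nat (l choose j) * (F (Suc j) + F j))"
proof -
  have "(\<Sum>j\<le>Suc l. of_nat (Suc l choose j) * F j) =
      (\<Sum>j\<le>l. of_nat (l choose j) * F (Suc j)) + (F 0 + (\<Sum>j\<le>l. of_nat (l choose Suc j) * F (Suc j)))"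
    by (subst sum.atMost_Suc_shift) (simp add: algebra_simps sum.distrib)
  also have "F 0 + (\<Sum>j\<le>l. of_nat (l choose Suc j) * F (Suc j)) = (\<Sum>j\<le>Suc l. of_nat (l choose j) * F j)"
    by (subst sum.atMost_Suc_shift) simp
  finally show ?thesis by (simp add: algebra_simps sum.distrib binomial_eq_0)
qed

lemma dderiv_pow_dvar_square:
  "(dderiv ^^ l) (dvar 0 * dvar 0) =
    (\<Sum>j\<le>l. of_nat (l choose j) * (dvar j * dvar (l - j)) :: 'k::comm_ring_1 dpoly)"
proof (induction l)
  case (Suc l)
  have "dderiv (of_nat c * p) = of_nat c * dderiv p" for c and p :: "'k dpoly"
    using dderiv_const[of "of_nat c :: 'k"] by (simp add: dderiv_mult)
  then have "(dderiv ^^ Suc l) (dvar 0 * dvar 0) = (\<Sum>j\<le>l. of_nat (l choose j) *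
      (dvar (Suc j) * dvar (l - j) + dvar j * dvar (Suc l - j) :: 'k dpoly))"
    by (simp add: Suc dderiv_sum dderiv_mult Suc_diff_le)
  also have "\<dots> = (\<Sum>j\<le>Suc l. of_nat (Suc l choose j) * (dvar j * dvar (Suc l - j)))"
    by (subst sum_choose_Suc) simp
  finally show ?case .
qed simp

text \<open>This is the l-th derivative of x_0^2 times the monomial m. It serves as a rewriting rule
  for monomials.\<close>

lemma dideal_x2_relation:
  "(\<Sum>j\<le>l. single (m + single j 1 + single (l - j) 1) (of_nat (l choose j))) \<in>
    (dideal_x2 :: 'k::comm_ring_1 dpoly set)"
proof -
  have "(dderiv ^^ l) (dvar 0 * dvar 0) \<in> (dideal_x2 :: 'k dpoly set)"
    by (induction l) (auto intro: dideal_x2.intros)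
  then have "single m (1::'k) * (dderiv ^^ l) (dvar 0 * dvar 0) \<in> dideal_x2" by (rule dideal_x2_mult)
  moreover have "single m 1 * (of_nat c * (dvar j * dvar k)) =
      single (m + single j 1 + single k 1) (of_nat c :: 'k)" for c j k
  proof -
    have "of_nat c = (single 0 (of_nat c) :: 'k dpoly)" by simp
    then show ?thesis by (simp only: dvar_def mult_single add.assoc mult_1 mult_1_right add_0)
  qed
  ultimately show ?thesis by (simp add: dderiv_pow_dvar_square sum_distrib_left)
qed

text \<open>The single inequality forces both exponents at most 1 and the absence of adjacent
  variables, that is, gaps of at least 2.\<close>

definition normal_mono :: "(nat \<Rightarrow>\<^sub>0 nat) \<Rightarrow> bool" where
  "normal_mono m \<longleftrightarrow> (\<forall>i. lookup m i + lookup m (Suc i) \<le> 1)"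

text \<open>For f = \<open>id\<close> this is the weight, which the relations preserve. For squares
  it measures how far the indices are spread, and it grows under rewriting.\<close>

definition moment :: "(nat \<Rightarrow> nat) \<Rightarrow> (nat \<Rightarrow>\<^sub>0 nat) \<Rightarrow> nat" where
  "moment f m = (\<Sum>i\<in>keys m. lookup m i * f i)"

lemma moment_add: "moment f (m + n) = moment f m + moment f n"
proof -
  have ext: "moment f l = (\<Sum>i\<in>keys m \<union> keys n. lookup l i * f i)" if "keys l \<subseteq> keys m \<union> keys n" for l
    unfolding moment_def using that by (intro sum.mono_neutral_left) (auto simp: in_keys_iff)
  show ?thesis
    using Poly_Mapping.keys_add[of m n] by (simp add: ext lookup_add sum.distrib algebra_simps)
qed

lemma moment_single [simp]: "moment f (single i n) = n * f i"
  by (simp add: moment_def)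

text \<open>Every index that occurs is at most the weight. The bound makes the squared weight minus
  the second moment a termination measure.\<close>

lemma moment_square_le: "moment (\<lambda>i. i\<^sup>2) m \<le> (moment id m)\<^sup>2"
proof -
  have "lookup m i * i\<^sup>2 \<le> lookup m i * i * moment id m" if "i \<in> keys m" for i
  proof -
    have "lookup m i * i \<le> moment id m"
      unfolding moment_def using that member_le_sum[of i "keys m" "\<lambda>i. lookup m i * id i"] by simp
    moreover have "i \<le> lookup m i * i" using that by (cases "lookup m i") (auto simp: in_keys_iff)
    ultimately have "i \<le> moment id m" by linarith
    then show ?thesis by (simp add: power2_eq_square)
  qed
  then have "moment (\<lambda>i. i\<^sup>2) m \<le> (\<Sum>i\<in>keys m. lookup m i * i * moment id m)"
    unfolding moment_def[of "\<lambda>i. i\<^sup>2"] by (intro sum_mono) auto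
  also have "\<dots> = (moment id m)\<^sup>2"
    by (simp add: moment_def power2_eq_square sum_distrib_right)
  finally show ?thesis .
qed

text \<open>Among pairs with a given sum the balanced one has the least sum of squares: moving both
  entries apart by d > 0 increases it.\<close>

lemma sum_squares_less_if_spread:
  fixes i i' j k :: nat
  assumes "i \<le> i'" "i' \<le> Suc i" "j + k = i + i'" "j \<noteq> i" "j \<noteq> i'"
  shows "i\<^sup>2 + i'\<^sup>2 < j\<^sup>2 + k\<^sup>2"
proof -
  have *: "i\<^sup>2 + i'\<^sup>2 < u\<^sup>2 + v\<^sup>2" if uv: "u + v = i + i'" "u < i" for u v
  proof -
    obtain d where d: "i = u + d" "d > 0" using uv(2) by (metis less_imp_add_positive)
    then have v: "v = i' + d" using uv(1) by simp
    have "u * d < i' * d" using assms(1) d by simp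
    then have "2 * (u * d) < 2 * (i' * d)" by linarith
    then show ?thesis unfolding v d(1) power2_sum by (simp add: mult.assoc)
  qed
  show ?thesis
  proof (cases "j < i")
    case False
    then have "k < i" using assms by linarith
    then show ?thesis using *[of k j] assms(3) by simp
  qed (use * assms in auto)
qed

lemma not_normal_monoE:
  assumes "\<not> normal_mono m"
  obtains m' i i' where "m = m' + single i 1 + single i' 1" "i \<le> i'" "i' \<le> Suc i"
proof -
  obtain i where "lookup m i + lookup m (Suc i) \<ge> 2"
    using assms unfolding normal_mono_def by (metis Suc_1 not_less_eq_eq)
  then consider "lookup m i \<ge> 2" | "lookup m (Suc i) \<ge> 2" | "lookup m i \<ge> 1" "lookup m (Suc i) \<ge> 1"
    by linarith
  then obtain u v where uv: "u \<le> v" "v \<le> Suc u"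
    "(u = v \<and> lookup m u \<ge> 2) \<or> (u \<noteq> v \<and> lookup m u \<ge> 1 \<and> lookup m v \<ge> 1)"
    by (metis le_refl le_SucI n_not_Suc_n)
  have "m = (m - single u 1 - single v 1) + single u 1 + single v 1"
    using uv(3) by (intro poly_mapping_eqI) (auto simp: lookup_add lookup_minus lookup_single when_def)
  then show ?thesis using that uv by blast
qed

text \<open>A monomial that is not normal contains x_i x_i' with i' equal to i or i+1. The relation
  of order i + i' is solved for it; all other terms have the same weight but are more spread, so the
  induction hypothesis applies to them.\<close>

lemma single_normal_representative:
  fixes c :: "'k::field_char_0"
  shows "\<exists>q. single m c - q \<in> dideal_x2 \<and> (\<forall>n\<in>keys q. normal_mono n)"
proof (induction "(moment id m)\<^sup>2 - moment (\<lambda>i. i\<^sup>2) m" arbitrary: m c rule: less_induct)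
  case less
  show ?case
  proof (cases "normal_mono m")
    case True
    then show ?thesis by (intro exI[of _ "single m c"]) (auto intro: dideal_x2.zero)
  next
    case False
    then obtain m' i i' where m: "m = m' + single i 1 + single i' 1" and ii: "i \<le> i'" "i' \<le> Suc i"
      by (rule not_normal_monoE)
    define l where "l = i + i'"
    define G where "G = {i, i'}"
    define M where "M j = m' + single j 1 + single (l - j) 1" for j
    \<comment> \<open>The coefficient of m in the relation. For i = i' the set G counts the index
      once, just as the relation does. C is a positive integer, hence invertible in characteristic
      0.\<close>
    define C :: 'k where "C = (\<Sum>j\<in>G. of_nat (l choose j))"
    \<comment> \<open>The coefficients of the other monomials after the relation is solved for c
      m.\<close>
    define a where "a j = - c * of_nat (l choose j) / C" for j
    have G: "G \<subseteq> {..l}" by (auto simp: G_def l_def)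
    have MG: "M j = m" if "j \<in> G" for j
      using that by (auto simp: M_def G_def l_def m add_ac)
    have "C = of_nat (\<Sum>j\<in>G. l choose j)" by (simp add: C_def)
    moreover have "(\<Sum>j\<in>G. l choose j) > 0"
      using G by (intro sum_pos) (auto simp: G_def)
    ultimately have C: "C \<noteq> 0" by (metis of_nat_eq_0_iff less_numeral_extra(3))
    have "\<exists>q. single (M j) (a j) - q \<in> dideal_x2 \<and> (\<forall>n\<in>keys q. normal_mono n)"
      if j: "j \<in> {..l} - G" for j
    proof (rule less)
      have "moment id (M j) = moment id m"
        using j by (simp add: M_def m moment_add l_def)
      moreover have "moment (\<lambda>i. i\<^sup>2) m < moment (\<lambda>i. i\<^sup>2) (M j)"
        using sum_squares_less_if_spread[of i i' j "l - j"] ii j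
        by (simp add: M_def m moment_add l_def G_def)
      ultimately show "(moment id (M j))\<^sup>2 - moment (\<lambda>i. i\<^sup>2) (M j) < (moment id m)\<^sup>2 - moment (\<lambda>i. i\<^sup>2) m"
        using moment_square_le[of "M j"] by simp
    qed
    then obtain Q where Q: "\<And>j. j \<in> {..l} - G \<Longrightarrow> single (M j) (a j) - Q j \<in> dideal_x2"
      "\<And>j n. j \<in> {..l} - G \<Longrightarrow> n \<in> keys (Q j) \<Longrightarrow> normal_mono n"
      by metis
    let ?R = "\<Sum>j\<le>l. single (M j) (of_nat (l choose j) :: 'k)"
    have "single 0 (c / C) * ?R = (\<Sum>j\<le>l. single (M j) (- a j))"
      by (simp add: sum_distrib_left mult_single a_def)
    also have "\<dots> = (\<Sum>j\<in>G. single (M j) (- a j)) + (\<Sum>j\<in>{..l} - G. single (M j) (- a j))"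
      using sum.subset_diff[OF G, of "\<lambda>j. single (M j) (- a j)"] by (simp add: add.commute)
    also have "(\<Sum>j\<in>G. single (M j) (- a j)) = (\<Sum>j\<in>G. single m (- a j))"
      using MG by (intro sum.cong) simp_all
    also have "\<dots> = single m (\<Sum>j\<in>G. - a j)"
      by (rule poly_mapping_eqI) (simp add: lookup_sum lookup_single when_def sum_negf)
    also have "(\<Sum>j\<in>G. - a j) = c"
      using C by (simp add: a_def sum_distrib_left[symmetric] sum_divide_distrib[symmetric] C_def[symmetric])
    finally have "single m c - (\<Sum>j\<in>{..l} - G. Q j) =
        single 0 (c / C) * ?R + (\<Sum>j\<in>{..l} - G. single (M j) (a j) - Q j)"
      by (simp add: sum_subtractf sum_negf single_uminus)
    moreover have "single 0 (c / C) * ?R \<in> dideal_x2"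
      unfolding M_def by (rule dideal_x2_mult[OF dideal_x2_relation])
    ultimately have "single m c - (\<Sum>j\<in>{..l} - G. Q j) \<in> dideal_x2"
      using Q(1) by (auto intro!: dideal_x2.add dideal_x2_sum)
    moreover have "normal_mono n" if "n \<in> keys (\<Sum>j\<in>{..l} - G. Q j)" for n
    proof -
      have "(\<Sum>j\<in>{..l} - G. lookup (Q j) n) \<noteq> 0"
        using that by (simp add: in_keys_iff lookup_sum)
      then obtain j where "j \<in> {..l} - G" "lookup (Q j) n \<noteq> 0"
        by (meson sum.not_neutral_contains_not_neutral)
      then show ?thesis using Q(2) by (simp add: in_keys_iff)
    qed
    ultimately show ?thesis by blast
  qed
qed

lemma normal_representative:
  fixes p :: "'k::field_char_0 dpoly"
  obtains q where "p - q \<in> dideal_x2" "\<And>n. n \<in> keys q \<Longrightarrow> normal_mono n"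
proof -
  have "\<forall>m. \<exists>q. single m (lookup p m) - q \<in> dideal_x2 \<and> (\<forall>n\<in>keys q. normal_mono n)"
    using single_normal_representative by blast
  then obtain Q where Q: "\<And>m. single m (lookup p m) - Q m \<in> dideal_x2"
    "\<And>m n. n \<in> keys (Q m) \<Longrightarrow> normal_mono n"
    by metis
  have "(\<Sum>m\<in>keys p. single m (lookup p m) - Q m) \<in> dideal_x2"
    using Q(1) by (intro dideal_x2_sum)
  then have 1: "p - (\<Sum>m\<in>keys p. Q m) \<in> dideal_x2"
    by (simp add: sum_subtractf poly_mapping_eq_sum_single[symmetric])
  have 2: "normal_mono n" if "n \<in> keys (\<Sum>m\<in>keys p. Q m)" for n
  proof -
    have "(\<Sum>m\<in>keys p. lookup (Q m) n) \<noteq> 0"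
      using that by (simp add: in_keys_iff lookup_sum)
    then obtain m where "lookup (Q m) n \<noteq> 0"
      by (meson sum.not_neutral_contains_not_neutral)
    then show ?thesis using Q(2) by (simp add: in_keys_iff)
  qed
  show ?thesis using that[OF 1 2] .
qed

subsection \<open>The alternating functionals separate points modulo the ideal\<close>

text \<open>Comparison of coefficients for polynomial functions in several variables: one variable
  is treated at a time, since a univariate polynomial vanishing on an infinite field is
  zero.\<close>

lemma sum_prod_poly_eq_0D:
  fixes c :: "'x \<Rightarrow> 'k::field_char_0"
  assumes "finite V" "\<And>y. (\<Sum>x\<in>X. c x * (\<Prod>v\<in>V. poly (q x v) (y v))) = 0"
  shows "(\<Sum>x\<in>X. c x * (\<Prod>v\<in>V. coeff (q x v) (e v))) = 0"
  using assms
proof (induction V arbitrary: c rule: finite_induct)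
  case (insert v V)
  have "(\<Sum>x\<in>X. (c x * coeff (q x v) (e v)) * (\<Prod>w\<in>V. poly (q x w) (y w))) = 0" for y
  proof -
    let ?P = "\<Sum>x\<in>X. smult (c x * (\<Prod>w\<in>V. poly (q x w) (y w))) (q x v)"
    have "poly ?P t = 0" for t
    proof -
      have "(\<Prod>w\<in>V. poly (q x w) ((y(v := t)) w)) = (\<Prod>w\<in>V. poly (q x w) (y w))" for x
        using insert.hyps by (intro prod.cong) auto
      then show ?thesis
        using insert.prems[of "y(v := t)"] insert.hyps by (simp add: poly_sum mult_ac)
    qed
    then have "?P = 0" by (simp add: poly_all_0_iff_0[symmetric])
    then have "coeff ?P (e v) = 0" by simp
    then show ?thesis by (simp add: coeff_sum mult_ac)
  qed
  from insert.IH[OF this] show ?case using insert.hyps by (simp add: mult_ac)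
qed simp

text \<open>The order is lexicographic from x_0 upwards. Let a0 be the first index moved by \<rho>.
  Before a0 both products have the same factors; from a0 on all factors on the permuted side have
  index above e a0 + (a0 - s), so the variable with that index is missing there.\<close>

lemma permuted_mono_less:
  fixes e :: "nat \<Rightarrow> nat"
  assumes \<rho>: "\<rho> permutes {s..<s + n}" "\<rho> \<noteq> id" and e: "strict_mono_on {s..<s + n} e"
  shows "(\<Sum>a\<in>{s..<s + n}. single (e a + (\<rho> a - s)) (1::nat)) < (\<Sum>a\<in>{s..<s + n}. single (e a + (a - s)) 1)"
proof -
  let ?A = "{s..<s + n}"
  let ?h = "\<lambda>a. e a + (\<rho> a - s)" and ?f = "\<lambda>a. e a + (a - s)"
  define a0 where "a0 = (LEAST a. \<rho> a \<noteq> a)"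
  have "\<exists>a. \<rho> a \<noteq> a" using \<rho>(2) by auto
  then have a0: "\<rho> a0 \<noteq> a0" unfolding a0_def by (rule LeastI_ex)
  have fixed: "\<rho> a = a" if "a < a0" for a
    using not_less_Least[of a "\<lambda>a. \<rho> a \<noteq> a"] that unfolding a0_def by blast
  have a0A: "a0 \<in> ?A" using a0 \<rho>(1) by (meson permutes_not_in)
  have ge: "a0 \<le> \<rho> a" if "a \<ge> a0" for a
    using that fixed[of "\<rho> a"] permutes_inj[OF \<rho>(1)] by (metis injD leD leI)
  have lt: "?f a0 < ?h a" if "a \<in> ?A" "a \<ge> a0" for a
  proof (cases "a = a0")
    case True
    then show ?thesis using ge[of a0] a0 a0A by auto
  next
    case False
    then have "e a0 < e a" using e a0A that by (auto simp: strict_mono_on_def)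
    then show ?thesis using ge[OF that(2)] by linarith
  qed
  have f_mono: "?f a < ?f b" if "a \<in> ?A" "b \<in> ?A" "a < b" for a b
  proof -
    have "e a < e b" using e that by (auto simp: strict_mono_on_def)
    then show ?thesis using that by linarith
  qed
  have look: "lookup (\<Sum>a\<in>?A. single (u a) (1::nat)) k = (\<Sum>a\<in>?A. if u a = k then 1 else 0 :: nat)" for u k
    by (simp only: lookup_sum lookup_single when_def)
  have "lookup (\<Sum>a\<in>?A. single (?h a) (1::nat)) (?f a0) = 0"
    unfolding look
  proof (intro sum.neutral ballI)
    fix a assume a: "a \<in> ?A"
    show "(if ?h a = ?f a0 then 1 else 0) = (0::nat)"
      using lt[of a] f_mono[of a a0] fixed[of a] a a0A by (cases "a < a0") auto
  qed
  moreover have "lookup (\<Sum>a\<in>?A. single (?f a) (1::nat)) (?f a0) \<ge> 1"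
    unfolding look using member_le_sum[of a0 ?A "\<lambda>a. if ?f a = ?f a0 then 1 else (0::nat)"] a0A by simp
  moreover have "lookup (\<Sum>a\<in>?A. single (?h a) (1::nat)) k = lookup (\<Sum>a\<in>?A. single (?f a) 1) k"
    if "k < ?f a0" for k
    unfolding look
  proof (intro sum.cong refl)
    fix a assume a: "a \<in> ?A"
    show "(if ?h a = k then 1 else 0) = (if ?f a = k then 1 else (0::nat))"
    proof (cases "a < a0")
      case False
      then have "?f a0 \<le> ?f a" using f_mono[of a0 a] a a0A by (cases "a = a0") auto
      then show ?thesis using lt[of a] a that False by auto
    qed (simp add: fixed)
  qed
  ultimately show ?thesis
    unfolding less_poly_mapping.rep_eq less_fun_def by (intro exI[of _ "?f a0"]) auto
qed

text \<open>The monomial \<open>x\<^bsub>i 0\<^esub> \<cdots> x\<^bsub>i (n-1)\<^esub>\<close> with gaps at least 2 is detected by the coefficient of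
  \<open>\<Prod>\<^sub>a \<alpha>\<^sub>a\<^bsup>i a - a\<^esup> \<beta>\<^sub>a\<^bsup>a\<^esup>\<close> in the functional, which otherwise sees only lexicographically
  smaller monomials.\<close>

lemma alt_form_normal_nonzero:
  fixes p :: "'k::field_char_0 dpoly"
  assumes "p \<noteq> 0" and normal: "\<And>m. m \<in> keys p \<Longrightarrow> normal_mono m"
  shows "\<exists>n \<alpha> \<beta>. alt_form [s..<s + n] \<alpha> \<beta> p \<noteq> 0"
proof (rule ccontr)
  assume "\<not> ?thesis"
  then have alt0: "alt_form [s..<s + n] \<alpha> \<beta> p = 0" for n \<alpha> \<beta> by blast
  \<comment> \<open>The least monomial is chosen because permutations other than \<open>id\<close>
    will lead to still smaller monomials, which do not occur in p.\<close>
  define \<mu> where "\<mu> = Min (keys p)"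
  have "keys p \<noteq> {}" using assms(1) by simp
  then have \<mu>: "\<mu> \<in> keys p" and \<mu>_le: "\<And>m. m \<in> keys p \<Longrightarrow> \<mu> \<le> m"
    unfolding \<mu>_def by simp_all
  define ks where "ks = sorted_list_of_set (keys \<mu>)"
  define n where "n = length ks"
  define idx where "idx a = ks ! (a - s)" for a
  \<comment> \<open>The prospective exponents of the \<alpha> a. As the gaps are at least 2,
    subtracting the position leaves a strictly increasing sequence.\<close>
  define e where "e a = idx a - (a - s)" for a
  let ?A = "{s..<s + n}"
  have ks: "set ks = keys \<mu>" "distinct ks" "sorted_wrt (<) ks"
    by (simp_all add: ks_def)
  have norm: "lookup \<mu> i + lookup \<mu> (Suc i) \<le> 1" for i
    using normal[OF \<mu>] by (simp add: normal_mono_def)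
  have gap1: "ks ! u + 2 \<le> ks ! Suc u" if "Suc u < n" for u
  proof -
    have lt: "ks ! u < ks ! Suc u"
      using ks(3) that by (simp add: sorted_wrt_nth_less n_def)
    have "ks ! u \<in> keys \<mu>" "ks ! Suc u \<in> keys \<mu>"
      using that ks(1) nth_mem[of u ks] nth_mem[of "Suc u" ks] by (auto simp: n_def)
    then have "ks ! Suc u \<noteq> Suc (ks ! u)"
      using norm[of "ks ! u"] by (auto simp: in_keys_iff)
    then show ?thesis using lt by linarith
  qed
  have gap: "ks ! u + 2 * k \<le> ks ! (u + k)" if "u + k < n" for u k
    using that
  proof (induction k)
    case (Suc k)
    then show ?case using gap1[of "u + k"] by simp
  qed simp
  have idx_e: "idx a = e a + (a - s)" if "a \<in> ?A" for a
  proof -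
    have "a - s < n" using that by auto
    then have "a - s \<le> idx a" using gap[of 0 "a - s"] unfolding idx_def by simp
    then show ?thesis by (simp add: e_def)
  qed
  have e_mono: "strict_mono_on ?A e"
  proof (rule strict_mono_onI)
    fix a b assume ab: "a \<in> ?A" "b \<in> ?A" "a < b"
    then have "b - s = (a - s) + (b - a)" "b - s < n" by auto
    then have "idx a + 2 * (b - a) \<le> idx b"
      using gap[of "a - s" "b - a"] unfolding idx_def by simp
    then show "e a < e b" using idx_e[OF ab(1)] idx_e[OF ab(2)] ab by simp
  qed
  have "bij_betw ((!) ks) {..<n} (keys \<mu>)"
    using bij_betw_nth[of ks] ks n_def by auto
  moreover have "bij_betw (\<lambda>a. a - s) ?A {..<n}"
    by (rule bij_betwI[of _ _ _ "\<lambda>a. a + s"]) auto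
  ultimately have bij: "bij_betw idx ?A (keys \<mu>)"
    unfolding idx_def using bij_betw_trans by (fastforce simp: o_def)
  have "\<mu> = (\<Sum>i\<in>keys \<mu>. single i 1)"
  proof (subst poly_mapping_eq_sum_single[of \<mu>], intro sum.cong refl)
    fix i assume "i \<in> keys \<mu>"
    then have "lookup \<mu> i = 1" using norm[of i] by (simp add: in_keys_iff)
    then show "single i (lookup \<mu> i) = single i 1" by simp
  qed
  also have "\<dots> = (\<Sum>a\<in>?A. single (idx a) 1)"
    by (rule sum.reindex_bij_betw[OF bij, symmetric])
  finally have \<mu>_eq: "\<mu> = (\<Sum>a\<in>?A. single (idx a) 1)" .
  define V where "V = (\<Union>m\<in>keys p. keys m)"
  have V: "finite V" "\<And>m. m \<in> keys p \<Longrightarrow> keys m \<subseteq> V" by (auto simp: V_def)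
  define X where "X = {\<rho>. \<rho> permutes ?A} \<times> PiE ?A (\<lambda>_. V)"
  have finX: "finite X" using V by (auto simp: X_def finite_permutations intro: finite_PiE)
  define \<kappa> :: "(nat \<Rightarrow> nat) \<times> (nat \<Rightarrow> nat) \<Rightarrow> 'k" where
    "\<kappa> = (\<lambda>(\<rho>, i). of_int (sign \<rho>) * (of_nat (mono_weight i [s..<s + n]) * lookup p (\<Sum>a\<in>?A. single (i a) 1)))"
  define \<kappa>' :: "(nat \<Rightarrow> nat) \<times> (nat \<Rightarrow> nat) \<Rightarrow> 'k" where
    "\<kappa>' x = \<kappa> x * (\<Prod>a\<in>?A. of_nat (snd x a choose e a))" for x
  \<comment> \<open>The exponent of \<beta> b that remains once \<alpha> a is taken to the power e
    a. If the subtraction truncates, a binomial coefficient in \<open>\<kappa>'\<close> is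
    0.\<close>
  define r :: "(nat \<Rightarrow> nat) \<times> (nat \<Rightarrow> nat) \<Rightarrow> nat \<Rightarrow> nat" where "r = (\<lambda>(\<rho>, i) b. i (inv \<rho> b) - e (inv \<rho> b))"
  \<comment> \<open>Fact 1 expands the functional as a polynomial in the \<alpha> a. Fact 2 takes
    the coefficient with exponents e a, and fact 3 then takes the coefficient with exponents b - s
    in the \<beta> b.\<close>
  have 1: "(\<Sum>x\<in>X. \<kappa> x * (\<Prod>a\<in>?A. poly ([:\<beta> (fst x a), 1:] ^ snd x a) (\<alpha> a))) = 0" for \<alpha> \<beta>
  proof -
    have "const_term (iter_deriv g [s..<s + n] p) = (\<Sum>i\<in>PiE ?A (\<lambda>_. V). (\<Prod>a\<in>?A. g a ^ i a) *
        (of_nat (mono_weight i [s..<s + n]) * lookup p (\<Sum>a\<in>?A. single (i a) 1)))" for g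
      using const_term_iter_deriv[of "[s..<s + n]" V p g] V by simp
    then have "alt_form [s..<s + n] \<alpha> \<beta> p =
        (\<Sum>\<rho> | \<rho> permutes ?A. \<Sum>i\<in>PiE ?A (\<lambda>_. V). \<kappa> (\<rho>, i) * (\<Prod>a\<in>?A. (\<alpha> a + \<beta> (\<rho> a)) ^ i a))"
      by (simp add: alt_form_def \<kappa>_def sum_distrib_left mult_ac)
    also have "\<dots> = (\<Sum>x\<in>X. \<kappa> x * (\<Prod>a\<in>?A. (\<alpha> a + \<beta> (fst x a)) ^ snd x a))"
      unfolding X_def sum.cartesian_product by (simp add: case_prod_unfold)
    finally show ?thesis using alt0[of n \<alpha> \<beta>] by (simp add: add.commute)
  qed
  have 2: "(\<Sum>x\<in>X. \<kappa>' x * (\<Prod>b\<in>?A. poly (monom 1 (r x b)) (\<beta> b))) = 0" for \<beta>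
  proof -
    have "(\<Prod>a\<in>?A. coeff ([:\<beta> (fst x a), 1:] ^ snd x a) (e a)) =
       (\<Prod>a\<in>?A. of_nat (snd x a choose e a)) * (\<Prod>b\<in>?A. poly (monom 1 (r x b)) (\<beta> b))"
      if "x \<in> X" for x
    proof -
      obtain \<rho> i where x: "x = (\<rho>, i)" by fastforce
      have \<rho>: "\<rho> permutes ?A" using that x by (simp add: X_def)
      have "coeff ([:\<beta> (\<rho> a), 1:] ^ i a) (e a) = of_nat (i a choose e a) * \<beta> (\<rho> a) ^ (i a - e a)" for a
      proof (cases "e a \<le> i a")
        case False
        then show ?thesis
          using degree_linear_power[of "\<beta> (\<rho> a)" "i a"] by (simp add: coeff_eq_0 binomial_eq_0)
      qed (simp add: coeff_linear_poly_power)
      moreover have "(\<Prod>b\<in>?A. \<beta> b ^ r x b) = (\<Prod>a\<in>?A. \<beta> (\<rho> a) ^ (i a - e a))"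
        using prod.permute[OF \<rho>, of "\<lambda>b. \<beta> b ^ r x b"] permutes_inverses[OF \<rho>]
        by (simp add: o_def x r_def)
      ultimately show ?thesis by (simp add: x poly_monom prod.distrib)
    qed
    then show ?thesis
      using sum_prod_poly_eq_0D[OF _ 1[where \<beta> = \<beta>], of e] by (simp add: \<kappa>'_def mult.assoc)
  qed
  have 3: "(\<Sum>x\<in>X. \<kappa>' x * (\<Prod>b\<in>?A. coeff (monom 1 (r x b)) (b - s))) = 0"
    using sum_prod_poly_eq_0D[OF _ 2, of "\<lambda>b. b - s"] by simp
  \<comment> \<open>The only surviving summand: the identity permutation with the indices of \<mu>
    itself.\<close>
  define x0 where "x0 = (id :: nat \<Rightarrow> nat, restrict idx ?A)"
  have keys_V: "keys \<mu> \<subseteq> V" using V(2)[OF \<mu>] .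
  have x0: "x0 \<in> X"
    using bij_betwE[OF bij] keys_V by (auto simp: x0_def X_def permutes_id)
  have other: "\<kappa>' x * (\<Prod>b\<in>?A. coeff (monom 1 (r x b)) (b - s)) = 0" if "x \<in> X" "x \<noteq> x0" for x
  proof (rule ccontr)
    assume nz: "\<kappa>' x * (\<Prod>b\<in>?A. coeff (monom 1 (r x b)) (b - s)) \<noteq> 0"
    obtain \<rho> i where x: "x = (\<rho>, i)" by fastforce
    have \<rho>: "\<rho> permutes ?A" and i: "i \<in> PiE ?A (\<lambda>_. V)" using that x by (simp_all add: X_def)
    from nz have in_p: "(\<Sum>a\<in>?A. single (i a) 1) \<in> keys p"
      and bin: "\<And>a. a \<in> ?A \<Longrightarrow> (i a choose e a) \<noteq> 0"
      and co: "\<And>b. b \<in> ?A \<Longrightarrow> coeff (monom (1::'k) (r x b)) (b - s) \<noteq> 0"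
      by (auto simp: \<kappa>'_def \<kappa>_def x in_keys_iff)
    have i_eq: "i a = e a + (\<rho> a - s)" if a: "a \<in> ?A" for a
    proof -
      have "\<rho> a \<in> ?A" using permutes_in_image[OF \<rho>] a by blast
      from co[OF this] have "i a - e a = \<rho> a - s"
        by (simp add: x r_def permutes_inverses[OF \<rho>] split: if_splits)
      moreover have "e a \<le> i a" using bin[OF a] by (metis binomial_eq_0 leI)
      ultimately show ?thesis by simp
    qed
    have sum_eq: "(\<Sum>a\<in>?A. single (i a) 1) = (\<Sum>a\<in>?A. single (e a + (\<rho> a - s)) (1::nat))"
      by (intro sum.cong refl) (simp add: i_eq)
    show False
    proof (cases "\<rho> = id")
      case True
      then have "i = restrict idx ?A"
        using i i_eq idx_e by (intro extensionalityI[of _ ?A]) (auto simp: PiE_def)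
      then show False using that(2) True by (simp add: x x0_def)
    next
      case False
      have "(\<Sum>a\<in>?A. single (e a + (a - s)) (1::nat)) = \<mu>"
        unfolding \<mu>_eq by (intro sum.cong refl) (simp add: idx_e)
      with permuted_mono_less[OF \<rho> False e_mono] have "(\<Sum>a\<in>?A. single (i a) 1) < \<mu>"
        unfolding sum_eq by simp
      then show False using \<mu>_le[OF in_p] by simp
    qed
  qed
  have "\<kappa>' x0 * (\<Prod>b\<in>?A. coeff (monom 1 (r x0 b)) (b - s)) = 0"
  proof -
    have "(\<Sum>x\<in>X. \<kappa>' x * (\<Prod>b\<in>?A. coeff (monom 1 (r x b)) (b - s))) =
        (\<Sum>x\<in>{x0}. \<kappa>' x * (\<Prod>b\<in>?A. coeff (monom 1 (r x b)) (b - s)))"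
      using other x0 finX by (intro sum.mono_neutral_right) blast+
    then show ?thesis using 3 by simp
  qed
  moreover have "(\<Prod>b\<in>?A. coeff (monom (1::'k) (r x0 b)) (b - s)) = 1"
    by (intro prod.neutral) (auto simp: r_def x0_def idx_e)
  moreover have "\<kappa>' x0 \<noteq> 0"
  proof -
    have "(\<Sum>a\<in>?A. single (restrict idx ?A a) 1) = \<mu>"
      unfolding \<mu>_eq by (intro sum.cong refl) simp
    moreover have "of_nat (restrict idx ?A a choose e a) \<noteq> (0::'k)" if "a \<in> ?A" for a
    proof -
      have "e a \<le> idx a" using idx_e[OF that] by linarith
      then show ?thesis using that by simp
    qed
    ultimately show ?thesis
      using \<mu> mono_weight_nonzero by (auto simp: \<kappa>'_def \<kappa>_def x0_def in_keys_iff)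
  qed
  ultimately show False by (simp only: mult_1_right)
qed

text \<open>The functionals do not change when p is replaced by a normal representative, which is
  nonzero. The free offset s later gives two elements disjoint index blocks.\<close>

lemma alt_form_separates:
  fixes p :: "'k::field_char_0 dpoly"
  assumes "p \<notin> dideal_x2"
  shows "\<exists>n \<alpha> \<beta>. alt_form [s..<s + n] \<alpha> \<beta> p \<noteq> 0"
proof -
  obtain q where q: "p - q \<in> dideal_x2" "\<And>m. m \<in> keys q \<Longrightarrow> normal_mono m"
    using normal_representative[of p] by blast
  have "q \<noteq> 0" using q(1) assms by auto
  then obtain n \<alpha> \<beta> where nz: "alt_form [s..<s + n] \<alpha> \<beta> q \<noteq> 0"
    using alt_form_normal_nonzero[OF _ q(2)] by blast
  have "alt_form [s..<s + n] \<alpha> \<beta> (q + (p - q)) = alt_form [s..<s + n] \<alpha> \<beta> q"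
    unfolding alt_form_add using alt_form_dideal_x2[OF q(1)] by simp
  then show ?thesis using nz by (intro exI[of _ n] exI[of _ \<alpha>] exI[of _ \<beta>]) simp
qed

subsection \<open>A product that does not vanish\<close>

text \<open>A Vandermonde argument: by linearity the sum of c x Q(\<theta> x) vanishes for every
  polynomial Q, in particular for one whose roots are the values of \<theta> other than t.\<close>

lemma power_sums_eq_0D:
  fixes c \<theta> :: "'x \<Rightarrow> 'k::field_char_0"
  assumes "finite X" "\<And>l. (\<Sum>x\<in>X. c x * \<theta> x ^ l) = 0"
  shows "(\<Sum>x | x \<in> X \<and> \<theta> x = t. c x) = 0"
proof -
  define Q where "Q = (\<Prod>u\<in>\<theta> ` X - {t}. [:- u, 1:])"
  have "(\<Sum>x\<in>X. c x * poly Q (\<theta> x)) = (\<Sum>l\<le>degree Q. coeff Q l * (\<Sum>x\<in>X. c x * \<theta> x ^ l))"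
    unfolding poly_altdef sum_distrib_left by (subst sum.swap) (simp add: mult_ac)
  also have "\<dots> = 0" by (simp add: assms(2))
  finally have "(\<Sum>x\<in>X. c x * poly Q (\<theta> x)) = 0" .
  moreover have "(\<Sum>x\<in>X. c x * poly Q (\<theta> x)) = (\<Sum>x | x \<in> X \<and> \<theta> x = t. c x * poly Q (\<theta> x))"
    using assms(1) by (intro sum.mono_neutral_right) (auto simp: Q_def poly_prod)
  moreover have "\<dots> = poly Q t * (\<Sum>x | x \<in> X \<and> \<theta> x = t. c x)"
    by (simp add: sum_distrib_left mult.commute)
  moreover have "poly Q t \<noteq> 0"
    using assms(1) by (simp add: Q_def poly_prod)
  ultimately show ?thesis by simp
qed

section \<open>Deformation of the functionals and block permutations\<close>

lemma alt_form_cong: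
  assumes "\<And>a. a \<in> set xs \<Longrightarrow> \<alpha> a = \<alpha>' a" "\<And>a. a \<in> set xs \<Longrightarrow> \<beta> a = \<beta>' a"
  shows "alt_form xs \<alpha> \<beta> p = alt_form xs \<alpha>' \<beta>' p"
  unfolding alt_form_def
proof (intro sum.cong refl)
  fix \<rho> assume "\<rho> \<in> {\<rho>. \<rho> permutes set xs}"
  then have "iter_deriv (\<lambda>a. \<alpha> a + \<beta> (\<rho> a)) xs p = iter_deriv (\<lambda>a. \<alpha>' a + \<beta>' (\<rho> a)) xs p"
    using assms by (intro iter_deriv_cong) (simp add: permutes_in_image)
  then show "of_int (sign \<rho>) * const_term (iter_deriv (\<lambda>a. \<alpha> a + \<beta> (\<rho> a)) xs p) =
      of_int (sign \<rho>) * const_term (iter_deriv (\<lambda>a. \<alpha>' a + \<beta>' (\<rho> a)) xs p)" by simp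
qed

text \<open>Polynomial dependence on z ensures that a functional nonzero at z = 0 stays nonzero for
  all but finitely many z.\<close>

lemma alt_form_shift_poly:
  assumes "distinct xs"
  shows "\<exists>f. \<forall>z. alt_form xs (\<lambda>a. \<alpha> a + h a * z) (\<lambda>a. \<beta> a + h a * z) p = poly f z"
proof -
  define V where "V = (\<Union>m\<in>keys p. keys m)"
  have V: "finite V" "\<And>m. m \<in> keys p \<Longrightarrow> keys m \<subseteq> V" by (auto simp: V_def)
  have expand: "const_term (iter_deriv g xs p) = (\<Sum>i\<in>PiE (set xs) (\<lambda>_. V). (\<Prod>a\<in>set xs. g a ^ i a) *
      (of_nat (mono_weight i xs) * lookup p (\<Sum>a\<in>set xs. single (i a) 1)))" for g
    using const_term_iter_deriv[of xs V p g] V assms by simp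
  let ?f = "\<Sum>\<rho> | \<rho> permutes set xs. smult (of_int (sign \<rho>)) (\<Sum>i\<in>PiE (set xs) (\<lambda>_. V).
      smult (of_nat (mono_weight i xs) * lookup p (\<Sum>a\<in>set xs. single (i a) 1))
        (\<Prod>a\<in>set xs. [:\<alpha> a + \<beta> (\<rho> a), h a + h (\<rho> a):] ^ i a))"
  have "alt_form xs (\<lambda>a. \<alpha> a + h a * z) (\<lambda>a. \<beta> a + h a * z) p = poly ?f z" for z
    unfolding alt_form_def expand
    by (simp add: poly_sum poly_prod algebra_simps)
  then show ?thesis by blast
qed

text \<open>A permutation of A \<union> B preserving B also preserves A, so it is uniquely a
  composite of permutations of A and of B, and the sign is multiplicative.\<close>

lemma sum_block_permutations:
  fixes F G :: "(nat \<Rightarrow> nat) \<Rightarrow> 'k::comm_ring_1"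
  assumes fin: "finite A" "finite B" and disj: "A \<inter> B = {}"
    and F: "\<And>\<rho> \<sigma>. (\<And>a. a \<in> A \<Longrightarrow> \<rho> a = \<sigma> a) \<Longrightarrow> F \<rho> = F \<sigma>"
    and G: "\<And>\<rho> \<sigma>. (\<And>b. b \<in> B \<Longrightarrow> \<rho> b = \<sigma> b) \<Longrightarrow> G \<rho> = G \<sigma>"
  shows "(\<Sum>\<rho> | \<rho> permutes A \<union> B \<and> \<rho> ` B = B. of_int (sign \<rho>) * (F \<rho> * G \<rho>)) =
    (\<Sum>\<rho> | \<rho> permutes A. of_int (sign \<rho>) * F \<rho>) * (\<Sum>\<rho> | \<rho> permutes B. of_int (sign \<rho>) * G \<rho>)"
proof -
  let ?X = "{\<rho>. \<rho> permutes A} \<times> {\<rho>. \<rho> permutes B}"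
  have compA: "(\<rho> \<circ> \<sigma>) a = \<rho> a" if "\<rho> permutes A" "\<sigma> permutes B" "a \<in> A" for \<rho> \<sigma> a
  proof -
    have "a \<notin> B" using that disj by auto
    then show ?thesis using permutes_not_in[OF that(2)] by simp
  qed
  have compB: "(\<rho> \<circ> \<sigma>) b = \<sigma> b" if "\<rho> permutes A" "\<sigma> permutes B" "b \<in> B" for \<rho> \<sigma> b
  proof -
    have "\<sigma> b \<notin> A" using that disj permutes_in_image[OF that(2), of b] by auto
    then show ?thesis using permutes_not_in[OF that(1)] by simp
  qed
  have "(\<Sum>\<rho> | \<rho> permutes A \<union> B \<and> \<rho> ` B = B. of_int (sign \<rho>) * (F \<rho> * G \<rho>)) =
    (\<Sum>x\<in>?X. of_int (sign (fst x)) * F (fst x) * (of_int (sign (snd x)) * G (snd x)))"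
  proof (rule sum.reindex_bij_witness[of _ "\<lambda>(\<rho>, \<sigma>). \<rho> \<circ> \<sigma>" "\<lambda>\<rho>. (restrict_id \<rho> A, restrict_id \<rho> B)"])
    fix \<rho> assume "\<rho> \<in> {\<rho>. \<rho> permutes A \<union> B \<and> \<rho> ` B = B}"
    then have \<rho>: "\<rho> permutes A \<union> B" and im: "\<rho> ` B = B" by auto
    have "\<rho> ` A = A"
    proof -
      have "A = (A \<union> B) - B" using disj by auto
      then show ?thesis
        using im permutes_image[OF \<rho>] image_set_diff[OF permutes_inj[OF \<rho>], of "A \<union> B" B] by simp
    qed
    then have pA: "restrict_id \<rho> A permutes A" and pB: "restrict_id \<rho> B permutes B"
      using im permutes_inj[OF \<rho>]
      by (auto intro!: permutes_restrict_id bij_betw_imageI intro: inj_on_subset)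
    then show "(restrict_id \<rho> A, restrict_id \<rho> B) \<in> ?X" by simp
    show eq: "(case (restrict_id \<rho> A, restrict_id \<rho> B) of (\<rho>, \<sigma>) \<Rightarrow> \<rho> \<circ> \<sigma>) = \<rho>"
    proof
      fix x
      consider "x \<in> A" | "x \<in> B" | "x \<notin> A \<union> B" by blast
      then show "(case (restrict_id \<rho> A, restrict_id \<rho> B) of (\<rho>, \<sigma>) \<Rightarrow> \<rho> \<circ> \<sigma>) x = \<rho> x"
        using compA[OF pA pB, of x] compB[OF pA pB, of x] permutes_not_in[OF \<rho>, of x]
        by cases (auto simp: restrict_id_def)
    qed
    have "sign (restrict_id \<rho> A \<circ> restrict_id \<rho> B) = sign (restrict_id \<rho> A) * sign (restrict_id \<rho> B)"
      using pA pB fin by (intro sign_compose) (auto intro: permutes_imp_permutation)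
    then have "sign \<rho> = sign (restrict_id \<rho> A) * sign (restrict_id \<rho> B)" using eq by simp
    moreover have "F (restrict_id \<rho> A) = F \<rho>" by (rule F) simp
    moreover have "G (restrict_id \<rho> B) = G \<rho>" by (rule G) simp
    ultimately show "of_int (sign (fst (restrict_id \<rho> A, restrict_id \<rho> B))) * F (fst (restrict_id \<rho> A, restrict_id \<rho> B)) *
       (of_int (sign (snd (restrict_id \<rho> A, restrict_id \<rho> B))) * G (snd (restrict_id \<rho> A, restrict_id \<rho> B))) =
       of_int (sign \<rho>) * (F \<rho> * G \<rho>)"
      by (simp add: mult_ac)
  next
    fix x assume "x \<in> ?X"
    then obtain \<rho> \<sigma> where x: "x = (\<rho>, \<sigma>)" and \<rho>: "\<rho> permutes A" and \<sigma>: "\<sigma> permutes B" by auto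
    have "restrict_id (\<rho> \<circ> \<sigma>) A = \<rho>" "restrict_id (\<rho> \<circ> \<sigma>) B = \<sigma>"
      using compA[OF \<rho> \<sigma>] compB[OF \<rho> \<sigma>] permutes_not_in[OF \<rho>] permutes_not_in[OF \<sigma>]
      by (auto simp: restrict_id_def fun_eq_iff)
    then show "(restrict_id (case x of (\<rho>, \<sigma>) \<Rightarrow> \<rho> \<circ> \<sigma>) A, restrict_id (case x of (\<rho>, \<sigma>) \<Rightarrow> \<rho> \<circ> \<sigma>) B) = x"
      by (simp add: x)
    have "\<rho> \<circ> \<sigma> permutes A \<union> B"
      using permutes_subset[OF \<rho>, of "A \<union> B"] permutes_subset[OF \<sigma>, of "A \<union> B"]
      by (auto intro: permutes_compose)
    moreover have "(\<rho> \<circ> \<sigma>) ` B = B"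
      using compB[OF \<rho> \<sigma>] permutes_image[OF \<sigma>] by (metis image_cong)
    ultimately show "(case x of (\<rho>, \<sigma>) \<Rightarrow> \<rho> \<circ> \<sigma>) \<in> {\<rho>. \<rho> permutes A \<union> B \<and> \<rho> ` B = B}"
      by (simp add: x)
  qed
  then show ?thesis
    by (simp add: sum_product sum.cartesian_product case_prod_unfold)
qed

text \<open>The sum counts the elements of T in B minus those in A, so the maximum requires all of B
  and nothing of A.\<close>

lemma sum_block_sign_eq_card_iff:
  fixes A B T :: "nat set"
  assumes "finite A" "finite B" "A \<inter> B = {}" "T \<subseteq> A \<union> B"
  defines "h \<equiv> \<lambda>c. if c \<in> A then - 1 else 1 :: int"
  shows "(\<Sum>c\<in>T. h c) \<le> int (card B)" "(\<Sum>c\<in>T. h c) = int (card B) \<longleftrightarrow> T = B"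
proof -
  have T: "T = (T \<inter> A) \<union> (T \<inter> B)" using assms(4) by auto
  have "(\<Sum>c\<in>T. h c) = (\<Sum>c\<in>T \<inter> A. h c) + (\<Sum>c\<in>T \<inter> B. h c)"
    using assms by (subst T, subst sum.union_disjoint) auto
  also have "(\<Sum>c\<in>T \<inter> A. h c) = - int (card (T \<inter> A))" by (simp add: h_def)
  also have "(\<Sum>c\<in>T \<inter> B. h c) = (\<Sum>c\<in>T \<inter> B. 1)"
    using assms(3) by (intro sum.cong) (auto simp: h_def)
  finally have sum: "(\<Sum>c\<in>T. h c) = int (card (T \<inter> B)) - int (card (T \<inter> A))" by simp
  have le: "card (T \<inter> B) \<le> card B" using assms(2) by (intro card_mono) auto
  then show "(\<Sum>c\<in>T. h c) \<le> int (card B)" unfolding sum by linarith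
  show "(\<Sum>c\<in>T. h c) = int (card B) \<longleftrightarrow> T = B"
  proof
    assume "(\<Sum>c\<in>T. h c) = int (card B)"
    then have "card (T \<inter> B) = card B" "card (T \<inter> A) = 0" using le unfolding sum by linarith+
    then have "T \<inter> B = B" "T \<inter> A = {}"
      using assms(1,2) by (simp_all add: card_subset_eq)
    then show "T = B" using T by auto
  next
    assume "T = B"
    then show "(\<Sum>c\<in>T. h c) = int (card B)" unfolding sum using assms(3) by (simp add: Int_commute)
  qed
qed

text \<open>The derivation acts on the \<open>b\<close>-half of each summand of the functional evaluated at
  \<open>a * (dderiv ^^ l) b\<close> by a scalar. The shift by \<open>\<plusminus>z\<close> makes the scalar of the
  block diagonal summands different from all others, so that these summands, whose total is the
  product of a functional at \<open>a\<close> and one at \<open>b\<close>, can be isolated by varying \<open>l\<close>.\<close>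

lemma dideal_x2_mult_dderiv_pow:
  fixes a b :: "'k::field_char_0 dpoly"
  assumes a: "a \<notin> dideal_x2" and b: "b \<notin> dideal_x2"
  shows "\<exists>l. a * (dderiv ^^ l) b \<notin> dideal_x2"
proof (rule ccontr)
  assume "\<not> ?thesis"
  then have in_ideal: "a * (dderiv ^^ l) b \<in> dideal_x2" for l by blast
  obtain n \<alpha>1 \<beta>1 where nz1: "alt_form [0..<n] \<alpha>1 \<beta>1 a \<noteq> 0"
    using alt_form_separates[OF a, of 0] by auto
  obtain m \<alpha>2 \<beta>2 where nz2: "alt_form [n..<n + m] \<alpha>2 \<beta>2 b \<noteq> 0"
    using alt_form_separates[OF b, of n] by auto
  define A where "A = {0..<n}"
  define B where "B = {n..<n + m}"
  define U where "U = {0..<n + m}"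
  have AB: "finite A" "finite B" "A \<inter> B = {}" "U = A \<union> B" "card B = m"
    by (auto simp: A_def B_def U_def)
  define h where "h c = (if c \<in> A then - 1 else 1 :: int)" for c
  define \<alpha> where "\<alpha> c = (if c \<in> A then \<alpha>1 c else \<alpha>2 c)" for c
  define \<beta> where "\<beta> c = (if c \<in> A then \<beta>1 c else \<beta>2 c)" for c
  define \<alpha>z where "\<alpha>z z c = \<alpha> c + of_int (h c) * z" for z c
  define \<beta>z where "\<beta>z z c = \<beta> c + of_int (h c) * z" for z c
  obtain fa where fa: "\<And>z. alt_form [0..<n] (\<alpha>z z) (\<beta>z z) a = poly fa z"
    using alt_form_shift_poly[of "[0..<n]" \<alpha> "\<lambda>c. of_int (h c)" \<beta> a]
    unfolding \<alpha>z_def \<beta>z_def by auto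
  obtain fb where fb: "\<And>z. alt_form [n..<n + m] (\<alpha>z z) (\<beta>z z) b = poly fb z"
    using alt_form_shift_poly[of "[n..<n + m]" \<alpha> "\<lambda>c. of_int (h c)" \<beta> b]
    unfolding \<alpha>z_def \<beta>z_def by auto
  have "poly fa 0 \<noteq> 0"
  proof -
    have "alt_form [0..<n] (\<alpha>z 0) (\<beta>z 0) a = alt_form [0..<n] \<alpha>1 \<beta>1 a"
      by (rule alt_form_cong) (auto simp: \<alpha>z_def \<beta>z_def \<alpha>_def \<beta>_def A_def)
    then show ?thesis using nz1 fa[of 0] by simp
  qed
  then have fa0: "fa \<noteq> 0" by auto
  have "poly fb 0 \<noteq> 0"
  proof -
    have "alt_form [n..<n + m] (\<alpha>z 0) (\<beta>z 0) b = alt_form [n..<n + m] \<alpha>2 \<beta>2 b"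
      by (rule alt_form_cong) (auto simp: \<alpha>z_def \<beta>z_def \<alpha>_def \<beta>_def A_def)
    then show ?thesis using nz2 fb[of 0] by simp
  qed
  then have fb0: "fb \<noteq> 0" by auto
  \<comment> \<open>By \<open>iter_deriv_mult\<close> a summand of the functional on a product is
    given by a permutation and the set S of derivations that act on the first factor.\<close>
  define X where "X = {\<rho>. \<rho> permutes U} \<times> Pow U"
  have finX: "finite X" by (simp add: X_def U_def finite_permutations)
  define good where "good = {\<rho>. \<rho> permutes U \<and> \<rho> ` B = B} \<times> {A}"
  have good_X: "good \<subseteq> X" by (auto simp: good_def X_def AB)
  \<comment> \<open>The slope in z of the scalar \<open>\<theta>\<close>. Its maximum 2m is attained
    exactly on \<open>good\<close>, because U - S and its image under \<rho> must both equal
    B.\<close>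
  define k where "k = (\<lambda>(\<rho>, S). \<Sum>c\<in>U - S. h c + h (\<rho> c))"
  define \<theta>0 where "\<theta>0 = (\<lambda>(\<rho>, S). \<Sum>c\<in>U - S. \<alpha> c + \<beta> (\<rho> c))"
  define \<theta> where "\<theta> z = (\<lambda>(\<rho>, S). \<Sum>c\<in>U - S. \<alpha>z z c + \<beta>z z (\<rho> c))" for z
  define t0 where "t0 = (\<Sum>c\<in>B. \<alpha> c + \<beta> c)"
  have \<theta>_eq: "\<theta> z x = \<theta>0 x + of_int (k x) * z" for z x
    by (cases x) (simp add: \<theta>_def \<theta>0_def k_def \<alpha>z_def \<beta>z_def sum.distrib sum_distrib_left algebra_simps)
  have U_A: "U - A = B" using AB by auto
  have k_iff: "k x = 2 * int m \<longleftrightarrow> x \<in> good" if "x \<in> X" for x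
  proof -
    obtain \<rho> S where x: "x = (\<rho>, S)" by fastforce
    have \<rho>: "\<rho> permutes U" and S: "S \<subseteq> U" using that x by (auto simp: X_def)
    have sub: "U - S \<subseteq> A \<union> B" "\<rho> ` (U - S) \<subseteq> A \<union> B"
      using AB(4) permutes_image[OF \<rho>] by auto
    have k: "k x = (\<Sum>c\<in>U - S. h c) + (\<Sum>c\<in>\<rho> ` (U - S). h c)"
      using permutes_inj[OF \<rho>]
      by (simp add: x k_def sum.distrib sum.reindex inj_on_subset o_def)
    note le = sum_block_sign_eq_card_iff[OF AB(1-3) sub(1)] sum_block_sign_eq_card_iff[OF AB(1-3) sub(2)]
    have "k x = 2 * int m \<longleftrightarrow> U - S = B \<and> \<rho> ` (U - S) = B"
      using le unfolding k h_def[abs_def, symmetric] AB(5) by linarith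
    also have "\<dots> \<longleftrightarrow> x \<in> good"
      using S \<rho> U_A AB by (auto simp: x good_def)
    finally show ?thesis .
  qed
  have \<theta>0_good: "\<theta>0 x = t0" if x_good: "x \<in> good" for x
  proof -
    obtain \<rho> where x: "x = (\<rho>, A)" and \<rho>: "\<rho> permutes U" "\<rho> ` B = B"
      using x_good by (auto simp: good_def)
    have "(\<Sum>c\<in>B. \<beta> (\<rho> c)) = (\<Sum>c\<in>\<rho> ` B. \<beta> c)"
      using permutes_inj[OF \<rho>(1)] by (simp add: sum.reindex inj_on_subset o_def)
    then show ?thesis
      using \<rho>(2) by (simp add: x \<theta>0_def t0_def U_A sum.distrib)
  qed
  \<comment> \<open>The values of z to avoid: roots of the two functionals, and coincidences of the
    scalar of another summand with the common scalar of the good ones. Each such coincidence is a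
    linear equation with nonzero slope.\<close>
  define Z where "Z = {z. poly fa z = 0} \<union> {z. poly fb z = 0} \<union>
    (\<Union>x\<in>X - good. {z. poly [:\<theta>0 x - t0, of_int (k x - 2 * int m):] z = 0})"
  have "finite Z"
  proof -
    have "[:\<theta>0 x - t0, of_int (k x - 2 * int m):] \<noteq> 0" if "x \<in> X - good" for x
      using k_iff[of x] that by (simp del: of_int_diff)
    then show ?thesis
      unfolding Z_def using fa0 fb0 finX by (intro finite_UnI finite_UN_I poly_roots_finite) auto
  qed
  then obtain z where z: "z \<notin> Z"
    using infinite_UNIV_char_0 by (metis UNIV_I finite_subset subsetI)
  have \<theta>_good: "\<theta> z x = t0 + of_int (2 * int m) * z \<longleftrightarrow> x \<in> good" if "x \<in> X" for x
  proof
    assume eq: "\<theta> z x = t0 + of_int (2 * int m) * z"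
    show "x \<in> good"
    proof (rule ccontr)
      assume "x \<notin> good"
      then have "poly [:\<theta>0 x - t0, of_int (k x - 2 * int m):] z \<noteq> 0"
        using z that by (auto simp: Z_def)
      then show False using eq unfolding \<theta>_eq by (simp add: algebra_simps)
    qed
  next
    assume "x \<in> good"
    then show "\<theta> z x = t0 + of_int (2 * int m) * z"
      using k_iff[OF that] \<theta>0_good by (simp add: \<theta>_eq)
  qed
  let ?g = "\<lambda>\<rho> c. \<alpha>z z c + \<beta>z z (\<rho> c)"
  let ?in = "\<lambda>S. filter (\<lambda>c. c \<in> S) [0..<n + m]" and ?out = "\<lambda>S. filter (\<lambda>c. c \<notin> S) [0..<n + m]"
  define c where "c = (\<lambda>(\<rho>, S). of_int (sign \<rho>) *
    (const_term (iter_deriv (?g \<rho>) (?in S) a) * const_term (iter_deriv (?g \<rho>) (?out S) b)))"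
  have "(\<Sum>x\<in>X. c x * \<theta> z x ^ l) = 0" for l
  proof -
    have out: "(\<Sum>c\<leftarrow>?out S. ?g \<rho> c) = \<theta> z (\<rho>, S)" for \<rho> S
    proof -
      have "set (?out S) = U - S" by (auto simp: U_def)
      then show ?thesis by (simp add: \<theta>_def sum_list_distinct_conv_sum_set del: set_filter)
    qed
    have "0 = alt_form [0..<n + m] (\<alpha>z z) (\<beta>z z) (a * (dderiv ^^ l) b)"
      using alt_form_dideal_x2[OF in_ideal] by simp
    also have "\<dots> = (\<Sum>\<rho> | \<rho> permutes U. \<Sum>S\<in>Pow U. c (\<rho>, S) * \<theta> z (\<rho>, S) ^ l)"
      unfolding alt_form_def iter_deriv_mult[OF distinct_upt] lookup_sum const_term_mult
        const_term_iter_deriv_dderiv_pow out sum_distrib_left set_upt U_def[symmetric]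
      by (intro sum.cong refl) (simp add: c_def mult_ac)
    also have "\<dots> = (\<Sum>x\<in>X. c x * \<theta> z x ^ l)"
      unfolding X_def sum.cartesian_product by (simp add: case_prod_unfold)
    finally show ?thesis ..
  qed
  from power_sums_eq_0D[OF finX this, of "t0 + of_int (2 * int m) * z"]
  have "(\<Sum>x | x \<in> X \<and> \<theta> z x = t0 + of_int (2 * int m) * z. c x) = 0" .
  moreover have "{x. x \<in> X \<and> \<theta> z x = t0 + of_int (2 * int m) * z} = good"
    using \<theta>_good good_X by blast
  ultimately have "0 = (\<Sum>x\<in>good. c x)" by simp
  also have "\<dots> = (\<Sum>\<rho> | \<rho> permutes A \<union> B \<and> \<rho> ` B = B. c (\<rho>, A))"
    unfolding good_def sum.cartesian_product' AB(4)[symmetric] by simp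
  also have "\<dots> = (\<Sum>\<rho> | \<rho> permutes A \<union> B \<and> \<rho> ` B = B. of_int (sign \<rho>) *
    (const_term (iter_deriv (?g \<rho>) [0..<n] a) * const_term (iter_deriv (?g \<rho>) [n..<n + m] b)))"
  proof -
    have "[0..<n + m] = [0..<n] @ [n..<n + m]" using upt_add_eq_append[of 0 n m] by simp
    then have "?in A = [0..<n]" "?out A = [n..<n + m]"
      by (auto simp: A_def filter_empty_conv)
    then show ?thesis by (simp add: c_def)
  qed
  also have "\<dots> = alt_form [0..<n] (\<alpha>z z) (\<beta>z z) a * alt_form [n..<n + m] (\<alpha>z z) (\<beta>z z) b"
    unfolding alt_form_def set_upt A_def[symmetric] B_def[symmetric]
    by (intro sum_block_permutations AB(1-3) arg_cong[of _ _ const_term] iter_deriv_cong)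
      (simp_all add: A_def B_def)
  also have "\<dots> \<noteq> 0" using z by (simp add: fa fb Z_def)
  finally show False by simp
qed

subsection \<open>Ideals of the operator algebra\<close>

lemma dderiv_pow_zero [simp]: "(dderiv ^^ l) 0 = 0"
  by (induction l) simp_all

lemma dderiv_pow_dvar: "(dderiv ^^ l) (dvar i) = dvar (l + i)"
  by (induction l) simp_all

text \<open>The functional given by the single derivation d_1 takes the value 1 on every
  variable.\<close>

lemma dvar_notin_dideal_x2: "(dvar i :: 'k::field_char_0 dpoly) \<notin> dideal_x2"
proof
  assume "(dvar i :: 'k dpoly) \<in> dideal_x2"
  then have "alt_form [0] (\<lambda>_. 1) (\<lambda>_. 0) (dvar i :: 'k dpoly) = 0"
    by (rule alt_form_dideal_x2) simp
  then show False by (simp add: alt_form_def)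
qed

lemma lookup_op_mul_const_right:
  "lookup (op_mul u (single 0 c)) k =
    (\<Sum>i\<in>keys u. if k \<le> i then of_nat (i choose (i - k)) * lookup u i * (dderiv ^^ (i - k)) c else 0)"
proof -
  have "lookup (op_mul u (single 0 c)) k = (\<Sum>i\<in>keys u. \<Sum>l\<le>i.
      if i - l = k then of_nat (i choose l) * lookup u i * (dderiv ^^ l) c else 0)"
    by (cases "c = 0") (simp_all add: op_mul_def lookup_sum lookup_single when_def cong: if_cong)
  also have "\<dots> = (\<Sum>i\<in>keys u. if k \<le> i then of_nat (i choose (i - k)) * lookup u i * (dderiv ^^ (i - k)) c else 0)"
  proof (intro sum.cong refl)
    fix i
    have "(\<Sum>l\<le>i. if i - l = k then of_nat (i choose l) * lookup u i * (dderiv ^^ l) c else 0) =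
        (\<Sum>l\<le>i. if l = i - k then (if k \<le> i then of_nat (i choose l) * lookup u i * (dderiv ^^ l) c else 0) else 0)"
      by (intro sum.cong refl) auto
    then show "(\<Sum>l\<le>i. if i - l = k then of_nat (i choose l) * lookup u i * (dderiv ^^ l) c else 0) =
        (if k \<le> i then of_nat (i choose (i - k)) * lookup u i * (dderiv ^^ (i - k)) c else 0)"
      by simp
  qed
  finally show ?thesis .
qed

lemma lookup_op_mul_const_left: "lookup (op_mul (single 0 c) u) k = c * lookup u k"
proof (cases "c = 0")
  case False
  then have "lookup (op_mul (single 0 c) u) k = (\<Sum>j\<in>keys u. if j = k then c * lookup u j else 0)"
    by (simp add: op_mul_def lookup_sum lookup_single when_def)
  then show ?thesis by (auto simp: in_keys_iff)
qed (simp add: op_mul_def)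

lemma dideal_x2_of_nat_cancel:
  fixes p :: "'k::field_char_0 dpoly"
  assumes "of_nat (Suc n) * p \<in> dideal_x2"
  shows "p \<in> dideal_x2"
proof -
  have "single 0 (inverse (of_nat (Suc n))) * (of_nat (Suc n) * p) = p"
  proof -
    have "of_nat (Suc n) = (single 0 (of_nat (Suc n)) :: 'k dpoly)" by (simp only: single_of_nat)
    moreover have "single 0 (inverse (of_nat (Suc n))) * single 0 (of_nat (Suc n) :: 'k) = (1 :: 'k dpoly)"
      unfolding mult_single by (simp del: of_nat_Suc)
    ultimately show ?thesis by (simp only: mult.assoc[symmetric] mult_1)
  qed
  then show ?thesis using dideal_x2_mult[OF assms] by metis
qed

text \<open>Commuting with \<open>x\<^sub>s\<close> lowers the order by one and multiplies the leading coefficient by a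
  multiple of \<open>x\<^bsub>s+1\<^esub>\<close>.\<close>

lemma op_ideal_order_zero_element:
  fixes I :: "'k::field_char_0 dop set"
  assumes I: "op_ideal I" and "u \<in> I" "\<And>k. k > n \<Longrightarrow> lookup u k = 0" "lookup u n \<notin> dideal_x2"
  shows "\<exists>a. single 0 a \<in> I \<and> a \<notin> dideal_x2"
  using assms(2-)
proof (induction n arbitrary: u)
  case 0
  then have "u = single 0 (lookup u 0)"
    by (intro poly_mapping_eqI) (auto simp: lookup_single when_def)
  then show ?case using 0 by metis
next
  case (Suc n)
  \<comment> \<open>Starting from x_1 rather than x_0 produces a variable of the form x_(s+1), the
    derivative of the x_s used for the commutator.\<close>
  obtain s where "lookup u (Suc n) * (dderiv ^^ s) (dvar 1) \<notin> dideal_x2"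
    using dideal_x2_mult_dderiv_pow[OF Suc.prems(3) dvar_notin_dideal_x2] by blast
  then have s: "lookup u (Suc n) * dvar (Suc s) \<notin> dideal_x2"
    by (simp add: dderiv_pow_dvar)
  define w :: "'k dop" where "w = single 0 (dvar s)"
  have w: "w \<in> Ops" by (auto simp: Ops_def w_def kplus_def lookup_single when_def)
  define v where "v = op_mul u w + - op_mul w u"
  have v: "v \<in> I" using I Suc.prems(1) w unfolding op_ideal_def v_def by blast
  have keys: "keys u \<subseteq> {..Suc n}"
    using Suc.prems(2) by (auto simp: in_keys_iff not_less[symmetric])
  have uw: "lookup (op_mul u w) k =
      (\<Sum>i\<in>{k..Suc n}. of_nat (i choose (i - k)) * lookup u i * (dderiv ^^ (i - k)) (dvar s))" for k
  proof -
    have "lookup (op_mul u w) k = (\<Sum>i\<in>{..Suc n}. if k \<le> i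
        then of_nat (i choose (i - k)) * lookup u i * (dderiv ^^ (i - k)) (dvar s) else 0)"
      unfolding w_def lookup_op_mul_const_right
      using keys by (intro sum.mono_neutral_left) (auto simp: in_keys_iff)
    also have "\<dots> = (\<Sum>i\<in>{k..Suc n}. of_nat (i choose (i - k)) * lookup u i * (dderiv ^^ (i - k)) (dvar s))"
      by (intro sum.mono_neutral_cong_right) auto
    finally show ?thesis .
  qed
  have lv: "lookup v k = lookup (op_mul u w) k - dvar s * lookup u k" for k
    by (simp add: v_def lookup_minus w_def lookup_op_mul_const_left)
  have "{n..Suc n} = {n, Suc n}" by auto
  \<comment> \<open>The term i = n of the product cancels against \<open>op_mul w u\<close>; the
    term i = n + 1 supplies the binomial coefficient n + 1 and one derivative of x_s.\<close>
  then have "lookup v n = of_nat (Suc n) * (lookup u (Suc n) * dvar (Suc s))"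
    by (simp add: lv uw algebra_simps del: of_nat_Suc)
  then have "lookup v n \<notin> dideal_x2" using s dideal_x2_of_nat_cancel by metis
  moreover have "lookup v k = 0" if "k > n" for k
  proof (cases "k = Suc n")
    case True
    then show ?thesis by (simp add: lv uw)
  next
    case False
    then show ?thesis using that Suc.prems(2) by (simp add: lv uw)
  qed
  ultimately show ?case using Suc.IH[OF v] by blast
qed

lemma op_nonzero_ideal_order_zero_element:
  fixes I :: "'k::field_char_0 dop set"
  assumes "op_nonzero_ideal I"
  obtains a where "single 0 a \<in> I" "a \<notin> dideal_x2"
proof -
  have I: "op_ideal I" using assms by (simp add: op_nonzero_ideal_def)
  obtain u where u: "u \<in> I" "\<not> op_equiv u 0" using assms by (auto simp: op_nonzero_ideal_def)
  define M where "M = {k. lookup u k \<notin> dideal_x2}"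
  have M_iff: "k \<in> M \<longleftrightarrow> lookup u k \<notin> dideal_x2" for k by (simp add: M_def)
  have "M \<subseteq> keys u" using dideal_x2.zero by (auto simp: M_def in_keys_iff)
  then have "finite M" by (rule finite_subset) simp
  moreover have "M \<noteq> {}" using u(2) by (auto simp: op_equiv_def M_def)
  ultimately have Max: "Max M \<in> M" "\<And>k. k > Max M \<Longrightarrow> k \<notin> M"
    by (auto simp: Max_in)
  \<comment> \<open>Higher coefficients of u vanish only modulo the ideal. Saturation under
    \<open>op_equiv\<close> permits cutting them off, so that they become literally zero.\<close>
  define v where "v = (\<Sum>i\<le>Max M. single i (lookup u i))"
  have lv: "lookup v k = (if k \<le> Max M then lookup u k else 0)" for k
    by (auto simp: v_def lookup_sum lookup_single when_def)
  have "u \<in> Ops" using I u(1) by (auto simp: op_ideal_def)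
  then have "v \<in> Ops" by (auto simp: Ops_def lv kplus_def)
  moreover have "op_equiv u v"
    unfolding op_equiv_def lv using Max(2) dideal_x2.zero by (auto simp: M_iff not_le)
  ultimately have "v \<in> I" using I u(1) by (auto simp: op_ideal_def)
  moreover have "lookup v (Max M) \<notin> dideal_x2" using Max(1) M_iff by (simp add: lv)
  ultimately have "\<exists>a. single 0 a \<in> I \<and> a \<notin> dideal_x2"
    by (intro op_ideal_order_zero_element[OF I, of v "Max M"]) (auto simp: lv)
  then show ?thesis using that by blast
qed

theorem theorem2:
  fixes I J :: "'k::field_char_0 dop set"
  assumes "op_nonzero_ideal I" and "op_nonzero_ideal J"
  shows "\<exists>u\<in>I. \<exists>v\<in>J. \<not> op_equiv (op_mul u v) 0"
proof -
  obtain a where a: "single 0 a \<in> I" "a \<notin> dideal_x2"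
    using op_nonzero_ideal_order_zero_element[OF assms(1)] .
  obtain b where b: "single 0 b \<in> J" "b \<notin> dideal_x2"
    using op_nonzero_ideal_order_zero_element[OF assms(2)] .
  \<comment> \<open>Coefficients have zero constant term, so \<partial>^l alone is not an operator
    of the algebra. It is given a coefficient x_s with a x_s still nonzero modulo the ideal.\<close>
  obtain s where "a * (dderiv ^^ s) (dvar 0) \<notin> dideal_x2"
    using dideal_x2_mult_dderiv_pow[OF a(2) dvar_notin_dideal_x2] by blast
  then have s: "a * dvar s \<notin> dideal_x2" by (simp add: dderiv_pow_dvar)
  obtain l where l: "(a * dvar s) * (dderiv ^^ l) b \<notin> dideal_x2"
    using dideal_x2_mult_dderiv_pow[OF s b(2)] by blast
  have "single l (dvar s) \<in> (Ops :: 'k dop set)"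
    by (auto simp: Ops_def kplus_def lookup_single when_def)
  then have "op_mul (single 0 a) (single l (dvar s)) \<in> I"
    using assms(1) a(1) by (auto simp: op_nonzero_ideal_def op_ideal_def)
  moreover have "op_mul (single 0 a) (single l (dvar s)) = single l (a * dvar s)"
    by (rule poly_mapping_eqI) (simp add: lookup_op_mul_const_left lookup_single when_def)
  ultimately have u: "single l (a * dvar s) \<in> I" by simp
  have "a * dvar s \<noteq> 0" using s dideal_x2.zero by metis
  then have "lookup (op_mul (single l (a * dvar s)) (single 0 b)) 0 = (a * dvar s) * (dderiv ^^ l) b"
    by (simp add: lookup_op_mul_const_right)
  then have "\<not> op_equiv (op_mul (single l (a * dvar s)) (single 0 b)) 0"
    using l by (metis op_equiv_def lookup_zero diff_zero)
  then show ?thesis using u b(1) by blast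
qed

end
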